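(* Let $\mathcal{R}=\sum_{a\in X}h_a\otimes q_a\in\mathcal{A}\otimes\mathcal{A}$ be the rack universal $\mathcal{R}$-matrix, let $\hat{\mathcal{A}}$ be the decorated rack algebra, and let $\mathcal{F}\in\hat{\mathcal{A}}\otimes\hat{\mathcal{A}}$ be $\mathcal{F}=\sum_{b\in X}h_b\otimes w_b^{-1}$. Put $\mathcal{R}^F_{ij}:=\mathcal{F}_{ji}\mathcal{R}_{ij}\mathcal{F}_{ij}^{-1}$ for $i,j\in\{1,2,3\}$ distinct, and define $$\mathcal{F}_{1,23}:=\sum_{a\in X}h_a\otimes w_a^{-1}\otimes w_a^{-1},\qquad \mathcal{F}^*_{12,3}:=\sum_{a,b\in X}h_a\otimes h_{\sigma_a(b)}\otimes w_b^{-1}w_a^{-1}.$$ Suppose also that for every $a,b\in X$, $b\triangleright a=\sigma_b(\tau_{\sigma_a^{-1}(b)}(a))$. Then the following statements are true: (1) $\mathcal{F}_{12}\mathcal{F}^*_{12,3}=\mathcal{F}_{23}\mathcal{F}_{1,23}=:\mathcal{F}_{123}$. (2) For distinct $i,j,k\in\{1,2,3\}$: (i) $\mathcal{F}_{ikj}\mathcal{R}_{jk}=\mathcal{R}^F_{jk}\mathcal{F}_{ijk}$ and (ii) $\mathcal{F}_{jik}\mathcal{R}_{ij}=\mathcal{R}^F_{ij}\mathcal{F}_{ijk}$. That is, $\mathcal{F}$ is an admissible Drinfel'd twist.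
   Context: Decorated rack algebra: let $(X,\triangleright)$ be a magma that is finite, or such that $b\mapsto a\triangleright b$ is surjective for every $a\in X$, and let $\sigma_a,\tau_b:X\to X$ be maps ($a,b\in X$) with every $\sigma_a$ bijective. The decorated rack algebra is a unital associative algebra $\hat{\mathcal{A}}$ over a field $k$ generated by indeterminates $1_{\hat{\mathcal{A}}}$ (the unit), $q_a,q_a^{-1},h_a,w_a,w_a^{-1}$ ($a\in X$), with $h_a=h_b\Leftrightarrow a=b$, subject to the relations, for all $a,b\in X$: $q_a^{-1}q_a=q_aq_a^{-1}=1_{\hat{\mathcal{A}}}$, $q_aq_b=q_bq_{b\triangleright a}$, $h_ah_b=\delta_{a,b}h_a$, $q_bh_{b\triangleright a}=h_aq_b$, $w_a^{-1}w_a=w_aw_a^{-1}=1_{\hat{\mathcal{A}}}$, $w_aw_b=w_{\sigma_a(b)}w_{\tau_b(a)}$, $w_ah_b=h_{\sigma_a(b)}w_a$, $w_aq_b=q_{\sigma_a(b)}w_a$. The rack algebra $\mathcal{A}$ is the algebra on the generators $1,q_a,q_a^{-1},h_a$ only, with the relations above that involve only the $q$'s and $h$'s. Standing conventions: $\sum_{a\in X}h_a=1_{\hat{\mathcal{A}}}$; $X$ is finite or countably infinite (for infinite $X$ sums over $X$ are understood formally). Notation: for an element $\mathcal{T}$ of $\hat{\mathcal{A}}\otimes\hat{\mathcal{A}}$, $\mathcal{T}_{ij}$ is $\mathcal{T}$ placed with its first leg in tensor factor $i$ and its second leg in tensor factor $j$ of $\hat{\mathcal{A}}^{\otimes3}$.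 For $\mathcal{F}_{123}\in\hat{\mathcal{A}}^{\otimes3}$, $\mathcal{F}_{ijk}$ is obtained by permuting the tensor legs accordingly: $\mathcal{F}_{jik}=\pi_{ij}\circ\mathcal{F}_{ijk}$ and $\mathcal{F}_{ikj}=\pi_{jk}\circ\mathcal{F}_{ijk}$, where $\pi$ is the flip map. "Admissible Drinfel'd twist" means that statements (1) and (2) hold. *)

theory Defs
  imports
    "HOL-Algebra.Algebraic_Closure_Type"
    "HOL-Library.Poly_Mapping"
    "HOL-Library.Numeral_Type"
    "HOL-Library.Countable"
begin

section \<open>Presented algebras\<close>

text \<open>
  Words form the free monoid, written additively, so that \<^typ>\<open>'g list \<Rightarrow>\<^sub>0 'k\<close> with the
  convolution product of \<^theory>\<open>HOL-Library.Poly_Mapping\<close> is the free unital associative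
  \<open>k\<close>-algebra on the generators \<^typ>\<open>'g\<close>.
\<close>

instantiation list :: (type) monoid_add
begin
definition zero_list :: "'a list" where "zero_list = []"
definition plus_list :: "'a list \<Rightarrow> 'a list \<Rightarrow> 'a list" where "plus_list = (@)"
instance by standard (simp_all add: zero_list_def plus_list_def)
end

type_synonym ('g, 'k) free_algebra = "'g list \<Rightarrow>\<^sub>0 'k"

definition gen :: "'g \<Rightarrow> ('g, 'k::field) free_algebra" where
  "gen g = Poly_Mapping.single [g] 1"

definition relation_ideal ::
    "('g, 'k::field) free_algebra set \<Rightarrow> ('g, 'k) free_algebra set" where
  "relation_ideal S = genideal ring_of_type_algebra S"

definition presented_algebra ::
    "('g, 'k::field) free_algebra set \<Rightarrow> ('g, 'k) free_algebra set ring" where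
  "presented_algebra S = ring_of_type_algebra Quot relation_ideal S"

definition presented_class ::
    "('g, 'k::field) free_algebra set \<Rightarrow> ('g, 'k) free_algebra \<Rightarrow> ('g, 'k) free_algebra set" where
  "presented_class S p = relation_ideal S +>\<^bsub>ring_of_type_algebra\<^esub> p"

section \<open>The decorated rack algebra\<close>

datatype 'x rack_gen = Q 'x | Qinv 'x | H 'x | W 'x | Winv 'x

text \<open>
  A relator \<open>l - r\<close> stands for the relation \<open>l = r\<close>. The last rule is the standing convention
  \<open>\<Sum>\<^sub>a h\<^sub>a = 1\<close>, which is a relation in the algebra only for finite \<open>X\<close>; for infinite \<open>X\<close> it
  is imposed by the formal sums below, where the unit is the formal sum of all the \<open>h\<^sub>a\<close>.
\<close>

inductive_set rack_relators :: "('x \<Rightarrow> 'x \<Rightarrow> 'x) \<Rightarrow> ('x rack_gen, 'k::field) free_algebra set"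
  for rk :: "'x \<Rightarrow> 'x \<Rightarrow> 'x" (infixl \<open>\<triangleright>\<close> 70)
where
  "gen (Qinv a) * gen (Q a) - 1 \<in> rack_relators (\<triangleright>)"
| "gen (Q a) * gen (Qinv a) - 1 \<in> rack_relators (\<triangleright>)"
| "gen (Q a) * gen (Q b) - gen (Q b) * gen (Q (b \<triangleright> a)) \<in> rack_relators (\<triangleright>)"
| "gen (H a) * gen (H b) - (if a = b then gen (H a) else 0) \<in> rack_relators (\<triangleright>)"
| "gen (Q b) * gen (H (b \<triangleright> a)) - gen (H a) * gen (Q b) \<in> rack_relators (\<triangleright>)"
| "finite (UNIV :: 'x set) \<Longrightarrow> (\<Sum>a\<in>UNIV. gen (H a)) - 1 \<in> rack_relators (\<triangleright>)"

inductive_set decorated_relators ::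
    "('x \<Rightarrow> 'x \<Rightarrow> 'x) \<Rightarrow> ('x \<Rightarrow> 'x \<Rightarrow> 'x) \<Rightarrow> ('x \<Rightarrow> 'x \<Rightarrow> 'x)
      \<Rightarrow> ('x rack_gen, 'k::field) free_algebra set"
  for rk :: "'x \<Rightarrow> 'x \<Rightarrow> 'x" (infixl \<open>\<triangleright>\<close> 70) and \<sigma> \<tau> :: "'x \<Rightarrow> 'x \<Rightarrow> 'x"
where
  "r \<in> rack_relators (\<triangleright>) \<Longrightarrow> r \<in> decorated_relators (\<triangleright>) \<sigma> \<tau>"
| "gen (Winv a) * gen (W a) - 1 \<in> decorated_relators (\<triangleright>) \<sigma> \<tau>"
| "gen (W a) * gen (Winv a) - 1 \<in> decorated_relators (\<triangleright>) \<sigma> \<tau>"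
| "gen (W a) * gen (W b) - gen (W (\<sigma> a b)) * gen (W (\<tau> b a)) \<in> decorated_relators (\<triangleright>) \<sigma> \<tau>"
| "gen (W a) * gen (H b) - gen (H (\<sigma> a b)) * gen (W a) \<in> decorated_relators (\<triangleright>) \<sigma> \<tau>"
| "gen (W a) * gen (Q b) - gen (Q (\<sigma> a b)) * gen (W a) \<in> decorated_relators (\<triangleright>) \<sigma> \<tau>"

section \<open>Tensor powers of an algebra\<close>

text \<open>
  A \<open>k\<close>-algebra is given by a ring \<open>A\<close> and its structure map \<open>\<eta>\<close> from \<open>k\<close> to the centre of \<open>A\<close>.
  Its tensor power with one tensor factor for each element of the finite type \<^typ>\<open>'i\<close> is the
  free vector space on the families \<open>f :: 'i \<Rightarrow> 'a\<close> in \<open>A\<close>, with the factorwise product extended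
  bilinearly, modulo the relators that make \<open>f \<mapsto> \<Otimes>\<^sub>i f i\<close> multilinear. The linear span of these
  relators is already a two-sided ideal.
\<close>

definition linear_ext :: "('b \<Rightarrow> 'c) \<Rightarrow> ('b \<Rightarrow>\<^sub>0 'k::field) \<Rightarrow> ('c \<Rightarrow>\<^sub>0 'k)" where
  "linear_ext g p = (\<Sum>f\<in>Poly_Mapping.keys p. Poly_Mapping.single (g f) (Poly_Mapping.lookup p f))"

definition family_algebra :: "'a ring \<Rightarrow> (('i::finite \<Rightarrow> 'a) \<Rightarrow>\<^sub>0 'k::field) ring" where
  "family_algebra A = \<lparr>
     carrier = {p. \<forall>f\<in>Poly_Mapping.keys p. \<forall>i. f i \<in> carrier A},
     monoid.mult = (\<lambda>p q. \<Sum>f\<in>Poly_Mapping.keys p. \<Sum>g\<in>Poly_Mapping.keys q.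
               Poly_Mapping.single (\<lambda>i. f i \<otimes>\<^bsub>A\<^esub> g i) (Poly_Mapping.lookup p f * Poly_Mapping.lookup q g)),
     monoid.one = Poly_Mapping.single (\<lambda>i. \<one>\<^bsub>A\<^esub>) 1,
     zero = 0,
     add = (+) \<rparr>"

inductive_set multilinear_relators ::
    "'a ring \<Rightarrow> ('k::field \<Rightarrow> 'a) \<Rightarrow> (('i::finite \<Rightarrow> 'a) \<Rightarrow>\<^sub>0 'k) set"
  for A :: "'a ring" and \<eta> :: "'k \<Rightarrow> 'a"
where
  "\<lbrakk>\<forall>i. f i \<in> carrier A; x \<in> carrier A; y \<in> carrier A\<rbrakk> \<Longrightarrow>
     Poly_Mapping.single (f(i := x \<oplus>\<^bsub>A\<^esub> y)) 1
       - Poly_Mapping.single (f(i := x)) 1 - Poly_Mapping.single (f(i := y)) 1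
     \<in> multilinear_relators A \<eta>"
| "\<lbrakk>\<forall>i. f i \<in> carrier A; x \<in> carrier A\<rbrakk> \<Longrightarrow>
     Poly_Mapping.single (f(i := \<eta> c \<otimes>\<^bsub>A\<^esub> x)) 1 - Poly_Mapping.single (f(i := x)) c
     \<in> multilinear_relators A \<eta>"

definition tensor_ideal ::
    "'a ring \<Rightarrow> ('k::field \<Rightarrow> 'a) \<Rightarrow> (('i::finite \<Rightarrow> 'a) \<Rightarrow>\<^sub>0 'k) set" where
  "tensor_ideal A \<eta> = genideal (family_algebra A) (multilinear_relators A \<eta>)"

definition tensor_power ::
    "'a ring \<Rightarrow> ('k::field \<Rightarrow> 'a) \<Rightarrow> (('i::finite \<Rightarrow> 'a) \<Rightarrow>\<^sub>0 'k) set ring" where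
  "tensor_power A \<eta> = family_algebra A Quot tensor_ideal A \<eta>"

definition pure_tensor ::
    "'a ring \<Rightarrow> ('k::field \<Rightarrow> 'a) \<Rightarrow> ('i::finite \<Rightarrow> 'a) \<Rightarrow> (('i \<Rightarrow> 'a) \<Rightarrow>\<^sub>0 'k) set" where
  "pure_tensor A \<eta> f = tensor_ideal A \<eta> +>\<^bsub>family_algebra A\<^esub> Poly_Mapping.single f 1"

text \<open>
  For an injective \<open>s :: 'i \<Rightarrow> 'j\<close> the algebra homomorphism that places tensor leg \<open>l\<close> in tensor
  factor \<open>s l\<close> and the unit in all factors that are not hit.
\<close>

definition place_family :: "'a ring \<Rightarrow> ('i \<Rightarrow> 'j) \<Rightarrow> ('i \<Rightarrow> 'a) \<Rightarrow> ('j \<Rightarrow> 'a)" where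
  "place_family A s f = (\<lambda>j. if j \<in> range s then f (inv_into UNIV s j) else \<one>\<^bsub>A\<^esub>)"

definition place_tensor ::
    "'a ring \<Rightarrow> ('k::field \<Rightarrow> 'a) \<Rightarrow> ('i::finite \<Rightarrow> 'j::finite)
      \<Rightarrow> (('i \<Rightarrow> 'a) \<Rightarrow>\<^sub>0 'k) set \<Rightarrow> (('j \<Rightarrow> 'a) \<Rightarrow>\<^sub>0 'k) set" where
  "place_tensor A \<eta> s t =
     (\<Union>p\<in>t. tensor_ideal A \<eta> +>\<^bsub>family_algebra A\<^esub> linear_ext (place_family A s) p)"

section \<open>Formal sums\<close>

text \<open>
  Let \<open>h\<close> be a family of orthogonal idempotents of \<open>A\<close>, and write \<open>T\<close> for a tensor power of \<open>A\<close>
  and \<open>e\<^sub>c = \<Otimes>\<^sub>i h (c i)\<close>. Since \<open>\<Sum>\<^sub>c e\<^sub>c\<close> is to be the unit, an element of \<open>T\<close> is determined by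
  its components \<open>e\<^sub>c t\<close>. A formal element is an arbitrary family \<open>(u\<^sub>c)\<close> with \<open>u\<^sub>c \<in> e\<^sub>c T\<close>, read as
  the formal sum \<open>\<Sum>\<^sub>c u\<^sub>c\<close>; two of them are multiplied termwise,
  \<open>(u v)\<^sub>c = \<Sum>\<^sub>d u\<^sub>c v\<^sub>d\<close>. In the decorated rack algebra every generator commutes with the
  \<open>h\<^sub>a\<close> up to a relabelling, so that \<open>u\<^sub>c e\<^sub>d = 0\<close> and hence \<open>u\<^sub>c v\<^sub>d = 0\<close> for all but finitely
  many \<open>d\<close>. In other words this is the inverse limit of the
  \<open>(\<Sum>\<^sub>c\<^sub>\<in>\<^sub>S e\<^sub>c) T\<close> over the finite sets \<open>S\<close>. If \<^typ>\<open>'x\<close> is finite and \<open>\<Sum>\<^sub>a h\<^sub>a = 1\<close> in \<open>A\<close>, it is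
  \<open>T\<close> itself, with \<open>t\<close> corresponding to \<open>(e\<^sub>c t)\<close> and \<open>(u\<^sub>c)\<close> to the actual sum \<open>\<Sum>\<^sub>c u\<^sub>c\<close>.
\<close>

definition idem :: "'a ring \<Rightarrow> ('k::field \<Rightarrow> 'a) \<Rightarrow> ('x \<Rightarrow> 'a)
    \<Rightarrow> ('i::finite \<Rightarrow> 'x) \<Rightarrow> (('i \<Rightarrow> 'a) \<Rightarrow>\<^sub>0 'k) set" where
  "idem A \<eta> h c = pure_tensor A \<eta> (\<lambda>i. h (c i))"

definition supp_sum :: "'t ring \<Rightarrow> 's set \<Rightarrow> ('s \<Rightarrow> 't) \<Rightarrow> 't" where
  "supp_sum T S x = (\<Oplus>\<^bsub>T\<^esub>s\<in>{s\<in>S. x s \<noteq> \<zero>\<^bsub>T\<^esub>}. x s)"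

definition formal_tensor :: "'a ring \<Rightarrow> ('k::field \<Rightarrow> 'a) \<Rightarrow> ('x \<Rightarrow> 'a)
    \<Rightarrow> (('i::finite \<Rightarrow> 'x) \<Rightarrow> (('i \<Rightarrow> 'a) \<Rightarrow>\<^sub>0 'k) set) ring" where
  "formal_tensor A \<eta> h = (let T = tensor_power A \<eta>; e = idem A \<eta> h in \<lparr>
     carrier = {u. \<forall>c. u c \<in> carrier T \<and> e c \<otimes>\<^bsub>T\<^esub> u c = u c},
     monoid.mult = (\<lambda>u v c. supp_sum T UNIV (\<lambda>d. u c \<otimes>\<^bsub>T\<^esub> v d)),
     monoid.one = e,
     zero = (\<lambda>c. \<zero>\<^bsub>T\<^esub>),
     add = (\<lambda>u v c. u c \<oplus>\<^bsub>T\<^esub> v c) \<rparr>)"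

text \<open>The formal sum \<open>\<Sum>\<^sub>s x\<^sub>s\<close> of elements of \<open>T\<close> such that, for each \<open>c\<close>, almost all \<open>e\<^sub>c x\<^sub>s\<close> vanish.\<close>

definition formal_sum :: "'a ring \<Rightarrow> ('k::field \<Rightarrow> 'a) \<Rightarrow> ('x \<Rightarrow> 'a) \<Rightarrow> 's set
    \<Rightarrow> ('s \<Rightarrow> (('i::finite \<Rightarrow> 'a) \<Rightarrow>\<^sub>0 'k) set) \<Rightarrow> ('i \<Rightarrow> 'x) \<Rightarrow> (('i \<Rightarrow> 'a) \<Rightarrow>\<^sub>0 'k) set" where
  "formal_sum A \<eta> h S x = (\<lambda>c. let T = tensor_power A \<eta> in
     supp_sum T S (\<lambda>s. idem A \<eta> h c \<otimes>\<^bsub>T\<^esub> x s))"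

text \<open>
  Termwise extension of \<^const>\<open>place_tensor\<close>: of the terms \<open>e\<^sub>c (place s u\<^sub>d)\<close>, only the one with
  \<open>d = c \<circ> s\<close> is nonzero.
\<close>

definition place_formal :: "'a ring \<Rightarrow> ('k::field \<Rightarrow> 'a) \<Rightarrow> ('x \<Rightarrow> 'a) \<Rightarrow> ('i::finite \<Rightarrow> 'j::finite)
    \<Rightarrow> (('i \<Rightarrow> 'x) \<Rightarrow> (('i \<Rightarrow> 'a) \<Rightarrow>\<^sub>0 'k) set) \<Rightarrow> ('j \<Rightarrow> 'x) \<Rightarrow> (('j \<Rightarrow> 'a) \<Rightarrow>\<^sub>0 'k) set" where
  "place_formal A \<eta> h s u = (\<lambda>c.
     idem A \<eta> h c \<otimes>\<^bsub>tensor_power A \<eta>\<^esub> place_tensor A \<eta> s (u (c \<circ> s)))"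

text \<open>
  Two and three tensor factors are indexed by the types \<open>2\<close> and \<open>3\<close>, whose elements are
  \<open>1, 2\<close> and \<open>1, 2, 3\<close> (arithmetic is modular, so the last one is also \<open>0\<close>).
\<close>

definition legs2 :: "'b \<Rightarrow> 'b \<Rightarrow> 2 \<Rightarrow> 'b" where
  "legs2 x y = (\<lambda>l. if l = 1 then x else y)"

definition legs3 :: "'b \<Rightarrow> 'b \<Rightarrow> 'b \<Rightarrow> 3 \<Rightarrow> 'b" where
  "legs3 x y z = (\<lambda>l. if l = 1 then x else if l = 2 then y else z)"

section \<open>The elements of the twist construction\<close>

type_synonym ('x, 'k) dra = "('x rack_gen, 'k) free_algebra set"
type_synonym ('x, 'k, 'i) dra_tensor = "('i \<Rightarrow> 'x) \<Rightarrow> (('i \<Rightarrow> ('x, 'k) dra) \<Rightarrow>\<^sub>0 'k) set"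

context
  fixes rk :: "'x \<Rightarrow> 'x \<Rightarrow> 'x" (infixl \<open>\<triangleright>\<close> 70) and \<sigma> \<tau> :: "'x \<Rightarrow> 'x \<Rightarrow> 'x"
begin

definition dra :: "('x, 'k::field) dra ring" where
  "dra = presented_algebra (decorated_relators (\<triangleright>) \<sigma> \<tau>)"

definition dra_unit :: "'k::field \<Rightarrow> ('x, 'k) dra" where
  "dra_unit c = presented_class (decorated_relators (\<triangleright>) \<sigma> \<tau>) (Poly_Mapping.single [] c)"

definition dra_gen :: "'x rack_gen \<Rightarrow> ('x, 'k::field) dra" where
  "dra_gen g = presented_class (decorated_relators (\<triangleright>) \<sigma> \<tau>) (gen g)"

definition dra_q :: "'x \<Rightarrow> ('x, 'k::field) dra" where "dra_q a = dra_gen (Q a)"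
definition dra_h :: "'x \<Rightarrow> ('x, 'k::field) dra" where "dra_h a = dra_gen (H a)"
definition dra_winv :: "'x \<Rightarrow> ('x, 'k::field) dra" where "dra_winv a = dra_gen (Winv a)"

definition dra_formal :: "('x, 'k::field, 'i::finite) dra_tensor ring" where
  "dra_formal = formal_tensor dra dra_unit dra_h"

definition dra_pure :: "('i::finite \<Rightarrow> ('x, 'k::field) dra) \<Rightarrow> (('i \<Rightarrow> ('x, 'k) dra) \<Rightarrow>\<^sub>0 'k) set" where
  "dra_pure = pure_tensor dra dra_unit"

definition dra_sum :: "('s \<Rightarrow> (('i::finite \<Rightarrow> ('x, 'k::field) dra) \<Rightarrow>\<^sub>0 'k) set)
    \<Rightarrow> ('x, 'k, 'i) dra_tensor" where
  "dra_sum = formal_sum dra dra_unit dra_h UNIV"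

definition dra_place :: "('i::finite \<Rightarrow> 'j::finite) \<Rightarrow> ('x, 'k::field, 'i) dra_tensor
    \<Rightarrow> ('x, 'k, 'j) dra_tensor" where
  "dra_place = place_formal dra dra_unit dra_h"

text \<open>
  The rack algebra consists of the generators \<open>q\<^sub>a, q\<^sub>a\<^sup>-\<^sup>1, h\<^sub>a\<close> and \<^const>\<open>rack_relators\<close> only; its
  R-matrix is used in products with the twist, so it is taken in the decorated algebra.
\<close>

definition rack_R :: "('x, 'k::field, 2) dra_tensor" where
  "rack_R = dra_sum (\<lambda>a. dra_pure (legs2 (dra_h a) (dra_q a)))"

definition twist_F :: "('x, 'k::field, 2) dra_tensor" where
  "twist_F = dra_sum (\<lambda>b. dra_pure (legs2 (dra_h b) (dra_winv b)))"

definition twist_F1_23 :: "('x, 'k::field, 3) dra_tensor" where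
  "twist_F1_23 = dra_sum (\<lambda>a. dra_pure (legs3 (dra_h a) (dra_winv a) (dra_winv a)))"

definition twist_Fstar12_3 :: "('x, 'k::field, 3) dra_tensor" where
  "twist_Fstar12_3 = dra_sum (\<lambda>(a, b).
     dra_pure (legs3 (dra_h a) (dra_h (\<sigma> a b)) (dra_winv b \<otimes>\<^bsub>dra\<^esub> dra_winv a)))"

end

end

theory Submission
  imports Defs
begin

text \<open>
  All sums over \<open>X\<close> collapse to single terms. A formal tensor is its family of components
  \<open>u\<^sub>c\<close>, one for each labelling \<open>c\<close> of the legs by elements of \<open>X\<close>, and every factor that occurs in
  the statement has components of the form
  \<open>u\<^sub>c = \<Otimes>\<^sub>i h (c i) m (c, i)\<close>, where \<open>m (c, i)\<close> is a word in the \<open>q\<close>, \<open>w\<close> and \<open>w\<^sup>-\<^sup>1\<close>. These are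
  called monomials. The relations of the algebra move an idempotent through such a word at the cost
  of a relabelling: \<open>h (c i) m (c, i) = m (c, i) h (\<phi> c i)\<close>. Since the \<open>h\<^sub>a\<close> are
  orthogonal, in the product \<open>(u v)\<^sub>c = \<Sum>\<^sub>d u\<^sub>c v\<^sub>d\<close> only \<open>d = \<phi> c\<close> contributes. A product
  of monomials is thus again a monomial, with entries \<open>m (c, i) n (\<phi> c, i)\<close>
  (\<open>monomial_mult\<close>), and an identity between products of monomials can be checked for each
  labelling and each leg, in the algebra \<open>A\<close> itself.

  In this form \<open>\<F>\<^sub>i\<^sub>j\<close> carries \<open>w\<^sup>-\<^sup>1\<close>, indexed by the label of leg \<open>i\<close>, on leg \<open>j\<close>. Both
  factorisations of \<open>\<F>\<^sub>1\<^sub>2\<^sub>3\<close> carry \<open>1\<close>, \<open>w\<^sub>a\<^sup>-\<^sup>1\<close>, \<open>w\<^sub>b\<^sup>-\<^sup>1 w\<^sub>a\<^sup>-\<^sup>1\<close> on the legs labelled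
  \<open>a, b, c\<close>. The twisted R-matrix relabels \<open>(a, b)\<close> to \<open>(\<sigma>\<^sub>b a, \<tau>\<^sub>a b)\<close>; this is where \<open>b \<triangleright> a = \<sigma>\<^sub>b (\<tau> (\<sigma>\<^sub>a\<^sup>-\<^sup>1 b) a)\<close> enters
  (\<open>twisted_rmat_mult\<close>). With this, \<open>\<F>\<^sub>i\<^sub>k\<^sub>j \<R>\<^sub>j\<^sub>k = \<R>\<^sup>F\<^sub>j\<^sub>k \<F>\<^sub>i\<^sub>j\<^sub>k\<close> reduces to
  \<open>w\<^sub>a q\<^sub>b = q (\<sigma>\<^sub>a b) w\<^sub>a\<close>, and
  \<open>\<F>\<^sub>j\<^sub>i\<^sub>k \<R>\<^sub>i\<^sub>j = \<R>\<^sup>F\<^sub>i\<^sub>j \<F>\<^sub>i\<^sub>j\<^sub>k\<close> to \<open>w\<^sub>a w\<^sub>b = w (\<sigma>\<^sub>a b) w (\<tau>\<^sub>b a)\<close>.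

  For this calculus the tensor powers must be rings in which pure tensors multiply leg by leg and
  vanish as soon as one entry does, and placing legs must be well defined on classes.
\<close>

section \<open>The algebra of families\<close>

lemma linear_ext_single [simp]:
  "linear_ext g (Poly_Mapping.single f c) = Poly_Mapping.single (g f) c"
  by (simp add: linear_ext_def)

lemma linear_ext_add: "linear_ext g (p + q) = linear_ext g p + linear_ext g q"
  unfolding linear_ext_def by (rule setsum_keys_plus_distrib) (simp_all add: single_add)

lemma linear_ext_zero [simp]: "linear_ext g 0 = 0"
  by (simp add: linear_ext_def)

lemma linear_ext_diff: "linear_ext g (p - q) = linear_ext g p - linear_ext g q"
  using linear_ext_add[of g "p - q" q] by (simp add: algebra_simps)

lemma family_algebra_simps:
  "zero (family_algebra A) = 0"
  "p \<oplus>\<^bsub>family_algebra A\<^esub> q = p + q"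
  "\<one>\<^bsub>family_algebra A\<^esub> = Poly_Mapping.single (\<lambda>i. \<one>\<^bsub>A\<^esub>) 1"
  by (simp_all add: family_algebra_def)

lemma single_in_family_algebra:
  "(\<And>i. f i \<in> carrier A) \<Longrightarrow> Poly_Mapping.single f c \<in> carrier (family_algebra A)"
  by (simp add: family_algebra_def)

lemma zero_in_family_algebra: "0 \<in> carrier (family_algebra A)"
  by (simp add: family_algebra_def)

lemma add_in_family_algebra:
  assumes "p \<in> carrier (family_algebra A)" "q \<in> carrier (family_algebra A)"
  shows "p + q \<in> carrier (family_algebra A)"
  using assms keys_add[of p q] by (auto simp: family_algebra_def)

lemma diff_in_family_algebra:
  assumes "p \<in> carrier (family_algebra A)" "q \<in> carrier (family_algebra A)"
  shows "p - q \<in> carrier (family_algebra A)"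
  using assms keys_diff[of p q] by (auto simp: family_algebra_def)

text \<open>
  Products and linear extensions are additive in each argument, so that an identity between them
  needs to be checked on basis families only; this rule is the form in which that is used.
\<close>

lemma family_algebra_induct [consumes 1, case_names zero single add]:
  assumes "p \<in> carrier (family_algebra A)"
    and zero: "P 0"
    and single: "\<And>f c. (\<And>i. f i \<in> carrier A) \<Longrightarrow> P (Poly_Mapping.single f c)"
    and add: "\<And>p q. \<lbrakk>p \<in> carrier (family_algebra A); q \<in> carrier (family_algebra A); P p; P q\<rbrakk>
      \<Longrightarrow> P (p + q)"
  shows "P p"
  using assms(1)
proof (induction p rule: update_induct)
  case const
  show ?case by (rule zero)
next
  case (update p f c)
  have keys: "Poly_Mapping.keys (Poly_Mapping.update f c p) = insert f (Poly_Mapping.keys p)"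
    using update(1,2) by (simp add: keys_update)
  then have f: "f i \<in> carrier A" for i
    using update by (auto simp: family_algebra_def)
  have p: "p \<in> carrier (family_algebra A)"
    using keys update by (auto simp: family_algebra_def)
  have "Poly_Mapping.update f c p = p + Poly_Mapping.single f c"
    using update(1)
    by (intro poly_mapping_eqI) (auto simp: lookup_update lookup_add lookup_single in_keys_iff when_def)
  then show ?case
    using add[OF p single_in_family_algebra[where f = f and c = c, OF f]] update(3)[OF p] single[OF f]
    by simp
qed

lemma family_mult_single [simp]:
  "Poly_Mapping.single f a \<otimes>\<^bsub>family_algebra A\<^esub> Poly_Mapping.single g b
     = Poly_Mapping.single (\<lambda>i. f i \<otimes>\<^bsub>A\<^esub> g i) (a * b)"
  by (simp add: family_algebra_def)

lemma family_mult_zero [simp]: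
  "0 \<otimes>\<^bsub>family_algebra A\<^esub> q = 0" "p \<otimes>\<^bsub>family_algebra A\<^esub> 0 = 0"
  by (simp_all add: family_algebra_def)

lemma family_mult_add_left:
  "(p + p') \<otimes>\<^bsub>family_algebra A\<^esub> q = p \<otimes>\<^bsub>family_algebra A\<^esub> q + p' \<otimes>\<^bsub>family_algebra A\<^esub> q"
  unfolding family_algebra_def monoid.simps
  by (rule setsum_keys_plus_distrib) (simp_all add: single_add distrib_right sum.distrib)

lemma family_mult_add_right:
  "p \<otimes>\<^bsub>family_algebra A\<^esub> (q + q') = p \<otimes>\<^bsub>family_algebra A\<^esub> q + p \<otimes>\<^bsub>family_algebra A\<^esub> q'"
  unfolding family_algebra_def monoid.simps sum.distrib[symmetric]
  by (intro sum.cong refl setsum_keys_plus_distrib) (simp_all add: single_add distrib_left)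

lemma ring_family_algebra:
  assumes "monoid A"
  shows "ring (family_algebra A :: (('i::finite \<Rightarrow> 'a) \<Rightarrow>\<^sub>0 'k::field) ring)" (is "ring ?R")
proof (rule ringI)
  interpret A: monoid A by fact
  show "abelian_group ?R"
  proof (rule abelian_groupI)
    fix p assume "p \<in> carrier ?R"
    then show "\<exists>q\<in>carrier ?R. q \<oplus>\<^bsub>?R\<^esub> p = \<zero>\<^bsub>?R\<^esub>"
      by (intro bexI[of _ "0 - p"] diff_in_family_algebra zero_in_family_algebra)
        (simp_all add: family_algebra_simps)
  qed (simp_all add: family_algebra_simps add_in_family_algebra zero_in_family_algebra add_ac)
  have closed: "p \<otimes>\<^bsub>?R\<^esub> q \<in> carrier ?R" if "p \<in> carrier ?R" "q \<in> carrier ?R" for p q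
    using that(1)
  proof (induction p rule: family_algebra_induct)
    case (single f a)
    show ?case
      using that(2)
      by (induction q rule: family_algebra_induct)
        (simp_all add: single zero_in_family_algebra single_in_family_algebra family_mult_add_right
          add_in_family_algebra)
  qed (simp_all add: zero_in_family_algebra family_mult_add_left add_in_family_algebra)
  show "monoid ?R"
  proof (rule monoidI)
    fix p q r
    assume "p \<in> carrier ?R" and q: "q \<in> carrier ?R" and r: "r \<in> carrier ?R"
    then show "p \<otimes>\<^bsub>?R\<^esub> q \<otimes>\<^bsub>?R\<^esub> r = p \<otimes>\<^bsub>?R\<^esub> (q \<otimes>\<^bsub>?R\<^esub> r)"
    proof (induction p rule: family_algebra_induct)
      case f: (single f a)
      show ?case
        using q
      proof (induction q rule: family_algebra_induct)
        case g: (single g b)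
        show ?case
          using r
          by (induction r rule: family_algebra_induct)
            (simp_all add: f g A.m_assoc mult.assoc family_mult_add_right)
      qed (simp_all add: family_mult_add_left family_mult_add_right)
    qed (simp_all add: family_mult_add_left)
  next
    fix p assume p: "p \<in> carrier ?R"
    show "\<one>\<^bsub>?R\<^esub> \<otimes>\<^bsub>?R\<^esub> p = p"
      using p by (induction p rule: family_algebra_induct)
        (simp_all add: family_algebra_simps family_mult_add_right)
    show "p \<otimes>\<^bsub>?R\<^esub> \<one>\<^bsub>?R\<^esub> = p"
      using p by (induction p rule: family_algebra_induct)
        (simp_all add: family_algebra_simps family_mult_add_left)
  qed (simp_all add: closed family_algebra_simps single_in_family_algebra)
qed (simp_all add: family_algebra_simps family_mult_add_left family_mult_add_right)

section \<open>Pure tensors\<close>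

locale ring_with_scalars = ring A for A :: "'a ring" (structure) +
  fixes \<eta> :: "'k::field \<Rightarrow> 'a"
  assumes scalar_closed: "\<eta> c \<in> carrier A"
begin

lemma multilinear_relators_closed:
  "multilinear_relators A \<eta> \<subseteq> carrier (family_algebra A)"
proof
  fix r :: "('i::finite \<Rightarrow> 'a) \<Rightarrow>\<^sub>0 'k"
  assume "r \<in> multilinear_relators A \<eta>"
  then show "r \<in> carrier (family_algebra A)"
    by cases (auto simp: scalar_closed intro!: diff_in_family_algebra single_in_family_algebra)
qed

lemma ideal_tensor_ideal:
  "ideal (tensor_ideal A \<eta> :: (('i::finite \<Rightarrow> 'a) \<Rightarrow>\<^sub>0 'k) set) (family_algebra A)"
  unfolding tensor_ideal_def
  by (rule ring.genideal_ideal[OF ring_family_algebra[OF monoid_axioms] multilinear_relators_closed])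

lemma ring_tensor_power: "ring (tensor_power A \<eta> :: (('i::finite \<Rightarrow> 'a) \<Rightarrow>\<^sub>0 'k) set ring)"
  unfolding tensor_power_def by (rule ideal.quotient_is_ring[OF ideal_tensor_ideal])

lemma tensor_class_hom:
  "ring_hom_ring (family_algebra A) (tensor_power A \<eta> :: (('i::finite \<Rightarrow> 'a) \<Rightarrow>\<^sub>0 'k) set ring)
     ((+>\<^bsub>family_algebra A\<^esub>) (tensor_ideal A \<eta>))"
  unfolding tensor_power_def by (rule ideal.rcos_ring_hom_ring[OF ideal_tensor_ideal])

lemma pure_tensor_closed [simp]:
  assumes "\<And>i. f i \<in> carrier A"
  shows "pure_tensor A \<eta> f \<in> carrier (tensor_power A \<eta>)"
proof -
  interpret hom: ring_hom_ring "family_algebra A" "tensor_power A \<eta>"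
    "(+>\<^bsub>family_algebra A\<^esub>) (tensor_ideal A \<eta>)"
    by (rule tensor_class_hom)
  show ?thesis
    unfolding pure_tensor_def using assms by (intro hom.hom_closed single_in_family_algebra)
qed

lemma pure_tensor_mult:
  assumes "\<And>i. f i \<in> carrier A" "\<And>i. g i \<in> carrier A"
  shows "pure_tensor A \<eta> f \<otimes>\<^bsub>tensor_power A \<eta>\<^esub> pure_tensor A \<eta> g = pure_tensor A \<eta> (\<lambda>i. f i \<otimes> g i)"
proof -
  interpret hom: ring_hom_ring "family_algebra A" "tensor_power A \<eta>"
    "(+>\<^bsub>family_algebra A\<^esub>) (tensor_ideal A \<eta>)"
    by (rule tensor_class_hom)
  show ?thesis
    unfolding pure_tensor_def
    using assms by (subst hom.hom_mult[symmetric]) (simp_all add: single_in_family_algebra)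
qed

lemma tensor_relator_zero:
  assumes "r \<in> multilinear_relators A \<eta>"
  shows "tensor_ideal A \<eta> +>\<^bsub>family_algebra A\<^esub> r = \<zero>\<^bsub>tensor_power A \<eta>\<^esub>"
proof -
  interpret I: ideal "tensor_ideal A \<eta>" "family_algebra A" by (rule ideal_tensor_ideal)
  have "r \<in> tensor_ideal A \<eta>"
    unfolding tensor_ideal_def
    using I.genideal_self[OF multilinear_relators_closed] assms by auto
  then show ?thesis
    by (simp add: I.a_rcos_const tensor_power_def FactRing_def)
qed

text \<open>
  The relator of additivity for \<open>0 + 0 = 0\<close> in leg \<open>i\<close> is minus the basis element of \<open>f\<close>.
\<close>

lemma pure_tensor_zero:
  assumes "\<And>i. f i \<in> carrier A" and zero: "f i = \<zero>"
  shows "pure_tensor A \<eta> f = \<zero>\<^bsub>tensor_power A \<eta>\<^esub>"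
proof -
  interpret hom: ring_hom_ring "family_algebra A" "tensor_power A \<eta>"
    "(+>\<^bsub>family_algebra A\<^esub>) (tensor_ideal A \<eta>)"
    by (rule tensor_class_hom)
  let ?f = "Poly_Mapping.single f 1"
  have f: "?f \<in> carrier (family_algebra A)"
    using assms(1) by (rule single_in_family_algebra)
  have "f(i := \<zero>) = f"
    using zero by auto
  then have "- ?f \<in> multilinear_relators A \<eta>"
    using multilinear_relators.intros(1)[of f A \<zero> \<zero> i \<eta>] assms(1) by simp
  then have zero_class: "tensor_ideal A \<eta> +>\<^bsub>family_algebra A\<^esub> (- ?f) = \<zero>\<^bsub>tensor_power A \<eta>\<^esub>"
    by (rule tensor_relator_zero)
  have minus: "- ?f \<in> carrier (family_algebra A)"
    using diff_in_family_algebra[OF zero_in_family_algebra f] by simp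
  have "pure_tensor A \<eta> f = tensor_ideal A \<eta> +>\<^bsub>family_algebra A\<^esub> 0"
    using hom.hom_add[OF f minus] hom.hom_closed[OF f]
    by (simp add: pure_tensor_def zero_class family_algebra_simps)
  then show ?thesis
    using hom.hom_zero by (simp add: family_algebra_simps)
qed

text \<open>
  The union over representatives that defines placement is a union of equal cosets: the induced map
  from families to the larger tensor power is a ring homomorphism, and by injectivity of \<open>s\<close> it
  sends a relator in leg \<open>i\<close> to a relator in leg \<open>s i\<close>. Its kernel is therefore an ideal that contains
  all relators, hence the whole tensor ideal.
\<close>

lemma pure_tensor_place:
  fixes s :: "'i::finite \<Rightarrow> 'j::finite"
  assumes inj: "inj s" and f: "\<And>i. f i \<in> carrier A"
  shows "place_tensor A \<eta> s (pure_tensor A \<eta> f) = pure_tensor A \<eta> (place_family A s f)"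
proof -
  let ?FI = "family_algebra A :: (('i \<Rightarrow> 'a) \<Rightarrow>\<^sub>0 'k) ring"
    and ?FJ = "family_algebra A :: (('j \<Rightarrow> 'a) \<Rightarrow>\<^sub>0 'k) ring"
    and ?TJ = "tensor_power A \<eta> :: (('j \<Rightarrow> 'a) \<Rightarrow>\<^sub>0 'k) set ring"
  let ?\<phi> = "linear_ext (place_family A s) :: (('i \<Rightarrow> 'a) \<Rightarrow>\<^sub>0 'k) \<Rightarrow> (('j \<Rightarrow> 'a) \<Rightarrow>\<^sub>0 'k)"
  let ?\<psi> = "\<lambda>p. tensor_ideal A \<eta> +>\<^bsub>?FJ\<^esub> ?\<phi> p"
  interpret hom: ring_hom_ring ?FJ ?TJ "(+>\<^bsub>?FJ\<^esub>) (tensor_ideal A \<eta>)"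
    by (rule tensor_class_hom)
  interpret FI: ring ?FI by (rule ring_family_algebra[OF monoid_axioms])
  have place_closed: "place_family A s g j \<in> carrier A" if "\<And>i. g i \<in> carrier A" for g j
    using that by (simp add: place_family_def)
  have closed: "?\<phi> p \<in> carrier ?FJ" if "p \<in> carrier ?FI" for p
    using that
    by (induction p rule: family_algebra_induct)
      (simp_all add: linear_ext_add zero_in_family_algebra add_in_family_algebra
        single_in_family_algebra place_closed)
  have place_mult: "place_family A s (\<lambda>i. g i \<otimes> g' i)
      = (\<lambda>j. place_family A s g j \<otimes> place_family A s g' j)" for g g'
    by (auto simp: place_family_def)
  have mult: "?\<phi> (p \<otimes>\<^bsub>?FI\<^esub> q) = ?\<phi> p \<otimes>\<^bsub>?FJ\<^esub> ?\<phi> q"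
    if p: "p \<in> carrier ?FI" and q: "q \<in> carrier ?FI" for p q
    using p
  proof (induction p rule: family_algebra_induct)
    case (single g a)
    show ?case
      using q by (induction q rule: family_algebra_induct)
        (simp_all add: linear_ext_add family_mult_add_right place_mult)
  qed (simp_all add: linear_ext_add family_mult_add_left)
  have "place_family A s (\<lambda>i. \<one>) = (\<lambda>j. \<one>)"
    by (auto simp: place_family_def)
  then have "?\<phi> \<in> ring_hom ?FI ?FJ"
    by (intro ring_hom_memI) (simp_all add: closed mult linear_ext_add family_algebra_simps)
  then have "?\<psi> \<in> ring_hom ?FI ?TJ"
    using ring_hom_trans[of ?\<phi> ?FI ?FJ "(+>\<^bsub>?FJ\<^esub>) (tensor_ideal A \<eta>)" ?TJ] hom.homh
    by (simp add: comp_def)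
  then interpret \<psi>: ring_hom_ring ?FI ?TJ ?\<psi>
    by (intro ring_hom_ringI2 FI.ring_axioms hom.S.ring_axioms)
  have place_upd: "place_family A s (g(i := x)) = (place_family A s g)(s i := x)" for g i x
    by (auto simp: place_family_def fun_eq_iff inv_into_f_f[OF inj] inj_eq[OF inj])
  have "?\<phi> r \<in> multilinear_relators A \<eta>" if "r \<in> multilinear_relators A \<eta>" for r
    using that
  proof cases
    case (1 g x y i)
    then show ?thesis
      using multilinear_relators.intros(1)[of "place_family A s g" A x y "s i" \<eta>]
      by (simp add: linear_ext_diff place_upd place_closed)
  next
    case (2 g x i c)
    then show ?thesis
      using multilinear_relators.intros(2)[of "place_family A s g" A x "s i" \<eta> c]
      by (simp add: linear_ext_diff place_upd place_closed)
  qed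
  then have "?\<psi> r = \<zero>\<^bsub>?TJ\<^esub>" if "r \<in> multilinear_relators A \<eta>" for r
    using that by (intro tensor_relator_zero)
  then have "multilinear_relators A \<eta> \<subseteq> a_kernel ?FI ?TJ ?\<psi>"
    unfolding a_kernel_def' using multilinear_relators_closed by blast
  then have "tensor_ideal A \<eta> \<subseteq> a_kernel ?FI ?TJ ?\<psi>"
    using FI.genideal_minimal[OF \<psi>.kernel_is_ideal] by (simp only: tensor_ideal_def)
  then have kernel: "?\<psi> r = \<zero>\<^bsub>?TJ\<^esub>" "r \<in> carrier ?FI" if "r \<in> tensor_ideal A \<eta>" for r
    using that unfolding a_kernel_def' by blast+
  let ?f = "Poly_Mapping.single f 1 :: ('i \<Rightarrow> 'a) \<Rightarrow>\<^sub>0 'k"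
  have carr: "?f \<in> carrier ?FI"
    using f by (rule single_in_family_algebra)
  have const: "?\<psi> p = ?\<psi> ?f" if p: "p \<in> pure_tensor A \<eta> f" for p
  proof -
    obtain r where r: "r \<in> tensor_ideal A \<eta>" and p_eq: "p = r \<oplus>\<^bsub>?FI\<^esub> ?f"
      using p by (auto simp: pure_tensor_def a_r_coset_def')
    show ?thesis
      unfolding p_eq using \<psi>.hom_add[OF kernel(2)[OF r] carr] kernel(1)[OF r] \<psi>.hom_closed[OF carr] by simp
  qed
  interpret I: ideal "tensor_ideal A \<eta>" ?FI by (rule ideal_tensor_ideal)
  have "?f \<in> pure_tensor A \<eta> f"
    unfolding pure_tensor_def by (rule I.a_rcos_self[OF carr])
  then have "place_tensor A \<eta> s (pure_tensor A \<eta> f) = ?\<psi> ?f"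
    unfolding place_tensor_def by (intro SUP_eq_const const) auto
  then show ?thesis
    by (simp add: pure_tensor_def)
qed

end

section \<open>Monomial formal tensors\<close>

lemma supp_sum_eq_single:
  fixes G :: "'t ring" (structure)
  assumes "abelian_monoid G" "s \<in> S" "x s \<in> carrier G"
    and zero: "\<And>s'. \<lbrakk>s' \<in> S; s' \<noteq> s\<rbrakk> \<Longrightarrow> x s' = \<zero>"
  shows "supp_sum G S x = x s"
proof -
  interpret abelian_monoid G by fact
  show ?thesis
  proof (cases "x s = \<zero>")
    case True
    then have "{s' \<in> S. x s' \<noteq> \<zero>} = {}"
      using zero by auto
    then show ?thesis
      using True by (simp only: supp_sum_def finsum_empty)
  next
    case False
    then have "{s' \<in> S. x s' \<noteq> \<zero>} = {s}"
      using assms(2) zero by auto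
    then show ?thesis
      using assms(3) by (simp add: supp_sum_def)
  qed
qed

locale idempotent_family = ring_with_scalars A \<eta>
  for A :: "'a ring" (structure) and \<eta> :: "'k::field \<Rightarrow> 'a" +
  fixes h :: "'x \<Rightarrow> 'a"
  assumes h_closed [simp]: "h x \<in> carrier A"
    and h_idem [simp]: "h x \<otimes> h x = h x"
    and h_orth: "x \<noteq> y \<Longrightarrow> h x \<otimes> h y = \<zero>"
begin

definition monomial ::
    "(('i::finite \<Rightarrow> 'x) \<Rightarrow> 'i \<Rightarrow> 'a) \<Rightarrow> ('i \<Rightarrow> 'x) \<Rightarrow> (('i \<Rightarrow> 'a) \<Rightarrow>\<^sub>0 'k) set" where
  "monomial m = (\<lambda>c. pure_tensor A \<eta> (\<lambda>i. h (c i) \<otimes> m c i))"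

text \<open>
  \<open>\<phi>\<close> records how the labels change when the idempotents are moved from the left of a monomial to its
  right.
\<close>

definition shifts :: "(('i::finite \<Rightarrow> 'x) \<Rightarrow> 'i \<Rightarrow> 'a) \<Rightarrow> (('i \<Rightarrow> 'x) \<Rightarrow> 'i \<Rightarrow> 'x) \<Rightarrow> bool" where
  "shifts m \<phi> \<longleftrightarrow> (\<forall>c i. m c i \<in> carrier A \<and> h (c i) \<otimes> m c i = m c i \<otimes> h (\<phi> c i))"

lemma shiftsD:
  assumes "shifts m \<phi>"
  shows "m c i \<in> carrier A" "h (c i) \<otimes> m c i = m c i \<otimes> h (\<phi> c i)"
  using assms by (auto simp: shifts_def)

lemma h_idem_left [simp]: "x \<in> carrier A \<Longrightarrow> h a \<otimes> (h a \<otimes> x) = h a \<otimes> x"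
  by (simp flip: m_assoc)

lemma monomial_cong:
  assumes "\<And>c i. h (c i) \<otimes> m c i = h (c i) \<otimes> n c i"
  shows "monomial m = monomial n"
  using assms by (simp add: monomial_def)

lemma monomial_in_tensor_power:
  assumes "\<And>c i. m c i \<in> carrier A"
  shows "monomial m c \<in> carrier (tensor_power A \<eta>)"
  using assms by (simp add: monomial_def)

lemma idem_mult_monomial:
  assumes "\<And>c i. m c i \<in> carrier A"
  shows "idem A \<eta> h c \<otimes>\<^bsub>tensor_power A \<eta>\<^esub> monomial m c = monomial m c"
  using assms by (simp add: idem_def monomial_def pure_tensor_mult)

lemma formal_tensor_carrier_iff:
  "u \<in> carrier (formal_tensor A \<eta> h) \<longleftrightarrow>
    (\<forall>c. u c \<in> carrier (tensor_power A \<eta>) \<and> idem A \<eta> h c \<otimes>\<^bsub>tensor_power A \<eta>\<^esub> u c = u c)"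
  by (simp add: formal_tensor_def Let_def)

lemma monomial_in_formal_tensor:
  assumes "\<And>c i. m c i \<in> carrier A"
  shows "monomial m \<in> carrier (formal_tensor A \<eta> h)"
  using assms by (simp add: formal_tensor_carrier_iff monomial_in_tensor_power idem_mult_monomial)

lemma one_formal_tensor: "\<one>\<^bsub>formal_tensor A \<eta> h\<^esub> = monomial (\<lambda>c i. \<one>)"
  by (simp add: formal_tensor_def Let_def idem_def monomial_def fun_eq_iff)

lemma idem_closed [simp]: "idem A \<eta> h c \<in> carrier (tensor_power A \<eta>)"
  by (simp add: idem_def)

lemma monomial_mult_idem:
  assumes m: "shifts m \<phi>"
  shows "monomial m c \<otimes>\<^bsub>tensor_power A \<eta>\<^esub> idem A \<eta> h d
    = (if d = \<phi> c then monomial m c else \<zero>\<^bsub>tensor_power A \<eta>\<^esub>)"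
proof -
  note [simp] = shiftsD(1)[OF m]
  have "monomial m c \<otimes>\<^bsub>tensor_power A \<eta>\<^esub> idem A \<eta> h d
      = pure_tensor A \<eta> (\<lambda>i. m c i \<otimes> (h (\<phi> c i) \<otimes> h (d i)))"
    by (simp add: monomial_def idem_def pure_tensor_mult shiftsD(2)[OF m] m_assoc)
  moreover have "pure_tensor A \<eta> (\<lambda>i. m c i \<otimes> (h (\<phi> c i) \<otimes> h (d i))) = monomial m c" if "d = \<phi> c"
    using that by (simp add: monomial_def shiftsD(2)[OF m])
  moreover have "pure_tensor A \<eta> (\<lambda>i. m c i \<otimes> (h (\<phi> c i) \<otimes> h (d i))) = \<zero>\<^bsub>tensor_power A \<eta>\<^esub>"
    if d: "d \<noteq> \<phi> c"
  proof -
    obtain i where "d i \<noteq> \<phi> c i"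
      using d by auto
    then show ?thesis
      by (intro pure_tensor_zero[of _ i]) (simp_all add: h_orth)
  qed
  ultimately show ?thesis
    by simp
qed

text \<open>
  The second factor is an arbitrary formal tensor: that an inverse is unique has to be shown against
  all elements of the carrier.
\<close>

lemma monomial_mult_component:
  fixes m :: "('i::finite \<Rightarrow> 'x) \<Rightarrow> 'i \<Rightarrow> 'a"
  assumes m: "shifts m \<phi>" and u: "u \<in> carrier (formal_tensor A \<eta> h)"
  shows "(monomial m \<otimes>\<^bsub>formal_tensor A \<eta> h\<^esub> u) c
    = monomial m c \<otimes>\<^bsub>tensor_power A \<eta>\<^esub> u (\<phi> c)"
proof -
  let ?T = "tensor_power A \<eta> :: (('i \<Rightarrow> 'a) \<Rightarrow>\<^sub>0 'k) set ring"
  interpret T: ring ?T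
    by (rule ring_tensor_power)
  have mc: "monomial m c \<in> carrier ?T"
    using shiftsD(1)[OF m] by (rule monomial_in_tensor_power)
  have u: "u d \<in> carrier ?T" "u d = idem A \<eta> h d \<otimes>\<^bsub>?T\<^esub> u d" for d
    using u by (simp_all add: formal_tensor_carrier_iff)
  have zero: "monomial m c \<otimes>\<^bsub>?T\<^esub> u d = \<zero>\<^bsub>?T\<^esub>" if "d \<noteq> \<phi> c" for d
  proof -
    have "monomial m c \<otimes>\<^bsub>?T\<^esub> u d = monomial m c \<otimes>\<^bsub>?T\<^esub> (idem A \<eta> h d \<otimes>\<^bsub>?T\<^esub> u d)"
      using u(2) by simp
    also have "\<dots> = monomial m c \<otimes>\<^bsub>?T\<^esub> idem A \<eta> h d \<otimes>\<^bsub>?T\<^esub> u d"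
      using mc u(1) by (simp add: T.m_assoc)
    also have "\<dots> = \<zero>\<^bsub>?T\<^esub>"
      using that u(1) by (simp add: monomial_mult_idem[OF m])
    finally show ?thesis .
  qed
  show ?thesis
    unfolding formal_tensor_def Let_def monoid.simps
    by (rule supp_sum_eq_single[OF T.abelian_monoid_axioms]) (simp_all add: zero mc u(1))
qed

lemma shifts_mult:
  fixes m :: "('i::finite \<Rightarrow> 'x) \<Rightarrow> 'i \<Rightarrow> 'a"
  assumes m: "shifts m \<phi>" and n: "shifts n \<psi>"
  shows "shifts (\<lambda>c i. m c i \<otimes> n (\<phi> c) i) (\<lambda>c. \<psi> (\<phi> c))"
  unfolding shifts_def
proof (intro allI conjI)
  fix c :: "'i \<Rightarrow> 'x" and i
  note [simp] = shiftsD(1)[OF m] shiftsD(1)[OF n]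
  show "m c i \<otimes> n (\<phi> c) i \<in> carrier A"
    by simp
  have "h (c i) \<otimes> (m c i \<otimes> n (\<phi> c) i) = m c i \<otimes> (h (\<phi> c i) \<otimes> n (\<phi> c) i)"
    by (simp add: shiftsD(2)[OF m] flip: m_assoc)
  also have "\<dots> = m c i \<otimes> n (\<phi> c) i \<otimes> h (\<psi> (\<phi> c) i)"
    by (simp add: shiftsD(2)[OF n] m_assoc)
  finally show "h (c i) \<otimes> (m c i \<otimes> n (\<phi> c) i) = m c i \<otimes> n (\<phi> c) i \<otimes> h (\<psi> (\<phi> c) i)" .
qed

lemma monomial_mult:
  assumes m: "shifts m \<phi>" and n: "\<And>c i. n c i \<in> carrier A"
  shows "monomial m \<otimes>\<^bsub>formal_tensor A \<eta> h\<^esub> monomial n = monomial (\<lambda>c i. m c i \<otimes> n (\<phi> c) i)"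
proof
  fix c
  note [simp] = shiftsD(1)[OF m] n
  have "h (c i) \<otimes> m c i \<otimes> (h (\<phi> c i) \<otimes> n (\<phi> c) i) = h (c i) \<otimes> (m c i \<otimes> n (\<phi> c) i)" for i
  proof -
    have "h (c i) \<otimes> m c i \<otimes> (h (\<phi> c i) \<otimes> n (\<phi> c) i) = h (c i) \<otimes> (m c i \<otimes> h (\<phi> c i)) \<otimes> n (\<phi> c) i"
      by (simp add: m_assoc)
    then show ?thesis
      by (simp flip: shiftsD(2)[OF m] add: m_assoc)
  qed
  then show "(monomial m \<otimes>\<^bsub>formal_tensor A \<eta> h\<^esub> monomial n) c = monomial (\<lambda>c i. m c i \<otimes> n (\<phi> c) i) c"
    using monomial_mult_component[OF m monomial_in_formal_tensor[of n]]
    by (simp add: monomial_def pure_tensor_mult)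
qed

text \<open>
  Associativity \<open>n (m u) = (n m) u\<close> with monomials \<open>m\<close> and \<open>n\<close>, seen in each component, already
  makes a right inverse \<open>u\<close> of \<open>m\<close> equal to its left inverse \<open>n\<close>. The two shifts have to undo each
  other for the component \<open>u\<^sub>c\<close> to reappear.
\<close>

lemma monomial_inv:
  fixes m :: "('i::finite \<Rightarrow> 'x) \<Rightarrow> 'i \<Rightarrow> 'a"
  assumes m: "shifts m \<phi>" and n: "shifts n \<psi>"
    and mn: "\<And>c i. m c i \<otimes> n (\<phi> c) i = \<one>" and nm: "\<And>c i. n c i \<otimes> m (\<psi> c) i = \<one>"
    and \<phi>\<psi>: "\<And>c. \<phi> (\<psi> c) = c"
  shows "inv\<^bsub>formal_tensor A \<eta> h\<^esub> (monomial m) = monomial n"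
  unfolding m_inv_def
proof (rule the_equality, intro conjI)
  let ?C = "formal_tensor A \<eta> h :: (('i \<Rightarrow> 'x) \<Rightarrow> (('i \<Rightarrow> 'a) \<Rightarrow>\<^sub>0 'k) set) ring"
  let ?T = "tensor_power A \<eta> :: (('i \<Rightarrow> 'a) \<Rightarrow>\<^sub>0 'k) set ring"
  interpret T: ring ?T
    by (rule ring_tensor_power)
  note [simp] = shiftsD(1)[OF m] shiftsD(1)[OF n]
  show "monomial n \<in> carrier ?C"
    by (simp add: monomial_in_formal_tensor)
  show "monomial m \<otimes>\<^bsub>?C\<^esub> monomial n = \<one>\<^bsub>?C\<^esub>" "monomial n \<otimes>\<^bsub>?C\<^esub> monomial m = \<one>\<^bsub>?C\<^esub>"
    by (simp_all add: monomial_mult[OF m] monomial_mult[OF n] one_formal_tensor mn nm)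
  fix u assume "u \<in> carrier ?C \<and> monomial m \<otimes>\<^bsub>?C\<^esub> u = \<one>\<^bsub>?C\<^esub> \<and> u \<otimes>\<^bsub>?C\<^esub> monomial m = \<one>\<^bsub>?C\<^esub>"
  then have u: "u \<in> carrier ?C" and mu: "monomial m \<otimes>\<^bsub>?C\<^esub> u = \<one>\<^bsub>?C\<^esub>"
    by simp_all
  have one: "monomial (\<lambda>c i. \<one>) = idem A \<eta> h"
    by (simp add: monomial_def idem_def fun_eq_iff)
  show "u = monomial n"
  proof
    fix c
    have uc: "u c \<in> carrier ?T" "idem A \<eta> h c \<otimes>\<^bsub>?T\<^esub> u c = u c"
      using u by (simp_all add: formal_tensor_carrier_iff)
    have "u c = (monomial n \<otimes>\<^bsub>?C\<^esub> monomial m) c \<otimes>\<^bsub>?T\<^esub> u c"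
      by (simp add: monomial_mult[OF n] nm one uc(2))
    also have "\<dots> = monomial n c \<otimes>\<^bsub>?T\<^esub> monomial m (\<psi> c) \<otimes>\<^bsub>?T\<^esub> u (\<phi> (\<psi> c))"
      by (simp add: monomial_mult_component[OF n] monomial_in_formal_tensor \<phi>\<psi>)
    also have "\<dots> = monomial n c \<otimes>\<^bsub>?T\<^esub> (monomial m \<otimes>\<^bsub>?C\<^esub> u) (\<psi> c)"
      using uc(1)
      by (simp add: monomial_mult_component[OF m u] \<phi>\<psi> T.m_assoc monomial_in_tensor_power)
    also have "\<dots> = monomial n c"
      by (simp add: mu one_formal_tensor one monomial_mult_idem[OF n])
    finally show "u c = monomial n c" .
  qed
qed

lemma place_formal_monomial:
  assumes s: "inj s" and m: "\<And>c i. m c i \<in> carrier A"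
  shows "place_formal A \<eta> h s (monomial m) = monomial (\<lambda>c. place_family A s (m (c \<circ> s)))"
proof
  fix c
  note [simp] = m
  have placed: "place_family A s f j \<in> carrier A" if "\<And>i. f i \<in> carrier A" for f j
    using that by (simp add: place_family_def)
  have "h (c j) \<otimes> place_family A s (\<lambda>i. h (c (s i)) \<otimes> m (c \<circ> s) i) j
      = h (c j) \<otimes> place_family A s (m (c \<circ> s)) j" for j
    by (auto simp: place_family_def inv_into_f_f[OF s])
  then show "place_formal A \<eta> h s (monomial m) c = monomial (\<lambda>c. place_family A s (m (c \<circ> s))) c"
    by (simp add: place_formal_def monomial_def idem_def pure_tensor_place[OF s] pure_tensor_mult placed)
qed

text \<open>
  \<open>g c\<close> is the index of the only summand that the idempotent of the labelling \<open>c\<close> does not kill.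
\<close>

lemma formal_sum_monomial:
  fixes m :: "('i::finite \<Rightarrow> 'x) \<Rightarrow> 'i \<Rightarrow> 'a"
  assumes f: "\<And>s i. f s i \<in> carrier A" and m: "\<And>c i. h (c i) \<otimes> f (g c) i = h (c i) \<otimes> m c i"
    and zero: "\<And>c s. s \<noteq> g c \<Longrightarrow> \<exists>i. h (c i) \<otimes> f s i = \<zero>"
  shows "formal_sum A \<eta> h UNIV (\<lambda>s. pure_tensor A \<eta> (f s)) = monomial m"
proof
  fix c :: "'i \<Rightarrow> 'x"
  let ?T = "tensor_power A \<eta> :: (('i \<Rightarrow> 'a) \<Rightarrow>\<^sub>0 'k) set ring"
  interpret T: ring ?T
    by (rule ring_tensor_power)
  have prod: "idem A \<eta> h c \<otimes>\<^bsub>?T\<^esub> pure_tensor A \<eta> (f s) = pure_tensor A \<eta> (\<lambda>i. h (c i) \<otimes> f s i)" for s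
    by (simp add: idem_def pure_tensor_mult f)
  have "idem A \<eta> h c \<otimes>\<^bsub>?T\<^esub> pure_tensor A \<eta> (f s) = \<zero>\<^bsub>?T\<^esub>" if s: "s \<noteq> g c" for s
  proof -
    obtain i where "h (c i) \<otimes> f s i = \<zero>"
      using zero[OF s] by blast
    then show ?thesis
      unfolding prod by (intro pure_tensor_zero[of _ i]) (simp_all add: f)
  qed
  then have "formal_sum A \<eta> h UNIV (\<lambda>s. pure_tensor A \<eta> (f s)) c
      = idem A \<eta> h c \<otimes>\<^bsub>?T\<^esub> pure_tensor A \<eta> (f (g c))"
    unfolding formal_sum_def Let_def by (intro supp_sum_eq_single[OF T.abelian_monoid_axioms]) (simp_all add: f)
  then show "formal_sum A \<eta> h UNIV (\<lambda>s. pure_tensor A \<eta> (f s)) c = monomial m c"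
    by (simp add: prod monomial_def m)
qed

end

section \<open>Monomials on two and three legs\<close>

lemma exhaust_2: "l = 1 \<or> l = 2" for l :: 2
proof -
  have "{1, 2 :: 2} = UNIV"
    by (rule card_subset_eq) simp_all
  then show ?thesis
    by auto
qed

lemma exhaust_3_distinct:
  fixes i j k l :: 3
  assumes "i \<noteq> j" "j \<noteq> k" "i \<noteq> k"
  shows "l = i \<or> l = j \<or> l = k"
proof -
  have "{i, j, k} = UNIV"
    using assms by (intro card_subset_eq) simp_all
  then show ?thesis
    by auto
qed

lemma legs2_simps [simp]: "legs2 x y 1 = x" "legs2 x y 2 = y"
  by (simp_all add: legs2_def)

lemma legs3_simps [simp]: "legs3 x y z 1 = x" "legs3 x y z 2 = y" "legs3 x y z 3 = z"
  by (simp_all add: legs3_def)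

lemma inj_legs2:
  assumes "i \<noteq> j"
  shows "inj (legs2 i j)"
proof (rule injI)
  fix l l' assume "legs2 i j l = legs2 i j l'"
  then show "l = l'"
    using exhaust_2[of l] exhaust_2[of l'] assms by auto
qed

lemma inj_legs3:
  assumes "i \<noteq> j" "j \<noteq> k" "i \<noteq> k"
  shows "inj (legs3 i j k)"
proof (rule injI)
  fix l l' assume "legs3 i j k l = legs3 i j k l'"
  then show "l = l'"
    using exhaust_3_distinct[of 1 2 3 l] exhaust_3_distinct[of 1 2 3 l'] assms by auto
qed

lemma place_family_hit: "inj s \<Longrightarrow> place_family A s f (s l) = f l"
  by (simp add: place_family_def)

context idempotent_family
begin

definition at_leg :: "'i::finite \<Rightarrow> (('i \<Rightarrow> 'x) \<Rightarrow> 'a) \<Rightarrow> ('i \<Rightarrow> 'x) \<Rightarrow> 'i \<Rightarrow> 'a" where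
  "at_leg j x = (\<lambda>c l. if l = j then x c else \<one>)"

lemma at_leg_simps [simp]:
  "at_leg j x c j = x c" "l \<noteq> j \<Longrightarrow> at_leg j x c l = \<one>"
  by (simp_all add: at_leg_def)

lemma shifts_at_leg:
  assumes "\<And>c. x c \<in> carrier A" "\<And>c. h (c j) \<otimes> x c = x c \<otimes> h (p c)"
  shows "shifts (at_leg j x) (\<lambda>c. c(j := p c))"
  using assms by (simp add: shifts_def at_leg_def)

lemma place_legs2:
  assumes ij: "i \<noteq> j" and x: "\<And>a. x a \<in> carrier A"
  shows "place_formal A \<eta> h (legs2 i j) (monomial (\<lambda>c. legs2 \<one> (x (c 1))))
    = monomial (at_leg j (\<lambda>c. x (c i)))"
proof -
  have "place_family A (legs2 i j) (legs2 \<one> y) l = (if l = j then y else \<one>)" for y l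
  proof (cases "l \<in> range (legs2 i j)")
    case True
    then obtain l' where "l = legs2 i j l'"
      by auto
    then show ?thesis
      using place_family_hit[OF inj_legs2[OF ij], of A "legs2 \<one> y" l'] exhaust_2[of l'] ij by auto
  next
    case False
    moreover have "j = legs2 i j 2"
      by simp
    ultimately have "l \<noteq> j"
      by (metis rangeI)
    then show ?thesis
      using False by (simp add: place_family_def)
  qed
  moreover have "legs2 \<one> (x a) l \<in> carrier A" for a l
    using x by (simp add: legs2_def)
  ultimately show ?thesis
    by (subst place_formal_monomial[OF inj_legs2[OF ij]]) (simp_all add: at_leg_def fun_eq_iff monomial_def)
qed

end

section \<open>The twist for a family with the decorated rack relations\<close>

lemma (in monoid) conjugate_inverse:
  assumes "a \<in> carrier G" "a' \<in> carrier G" "x \<in> carrier G" "y \<in> carrier G"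
    and "a \<otimes> a' = \<one>" "a' \<otimes> a = \<one>" and ax: "a \<otimes> x = y \<otimes> a"
  shows "a' \<otimes> y = x \<otimes> a'"
proof -
  have "a' \<otimes> y = a' \<otimes> (y \<otimes> a) \<otimes> a'"
    using assms by (simp add: m_assoc)
  also have "\<dots> = (a' \<otimes> a) \<otimes> x \<otimes> a'"
    using assms(1-4) by (simp only: ax[symmetric] m_assoc m_closed)
  finally show ?thesis
    using assms by simp
qed

text \<open>
  The decorated rack algebra is seen here as one instance of an algebra with elements that satisfy its
  relations, so that the computation takes place among elements of a ring and not among classes of
  words. The relation between \<open>h\<close> and \<open>q\<close> is read from right to left, as a shift rule for \<open>h\<close>.
\<close>

locale decorated_family = idempotent_family A \<eta> h
  for A :: "'a ring" (structure) and \<eta> :: "'k::field \<Rightarrow> 'a" and h :: "'x \<Rightarrow> 'a" +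
  fixes rk :: "'x \<Rightarrow> 'x \<Rightarrow> 'x" (infixl \<open>\<triangleright>\<close> 70) and \<sigma> \<tau> :: "'x \<Rightarrow> 'x \<Rightarrow> 'x"
    and q w winv :: "'x \<Rightarrow> 'a"
  assumes q_closed [simp]: "q a \<in> carrier A"
    and w_closed [simp]: "w a \<in> carrier A"
    and winv_closed [simp]: "winv a \<in> carrier A"
    and h_q: "h a \<otimes> q b = q b \<otimes> h (b \<triangleright> a)"
    and winv_w [simp]: "winv a \<otimes> w a = \<one>"
    and w_winv [simp]: "w a \<otimes> winv a = \<one>"
    and w_w: "w a \<otimes> w b = w (\<sigma> a b) \<otimes> w (\<tau> b a)"
    and w_h: "w a \<otimes> h b = h (\<sigma> a b) \<otimes> w a"
    and w_q: "w a \<otimes> q b = q (\<sigma> a b) \<otimes> w a"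
    and bij_\<sigma>: "bij (\<sigma> a)"
    and rack_eq: "b \<triangleright> a = \<sigma> b (\<tau> (inv_into UNIV (\<sigma> a) b) a)"
begin

lemma \<sigma>_inv [simp]: "\<sigma> a (inv_into UNIV (\<sigma> a) b) = b" "inv_into UNIV (\<sigma> a) (\<sigma> a b) = b"
  using bij_\<sigma>[of a] by (simp_all add: bij_is_surj surj_f_inv_f bij_is_inj inv_f_f)

lemma h_winv: "h b \<otimes> winv a = winv a \<otimes> h (\<sigma> a b)"
  using conjugate_inverse[OF _ _ _ _ w_winv winv_w w_h] by simp

lemma h_winv_mult: "x \<in> carrier A \<Longrightarrow> h b \<otimes> (winv a \<otimes> x) = winv a \<otimes> (h (\<sigma> a b) \<otimes> x)"
  by (simp add: h_winv flip: m_assoc)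

lemma q_winv: "winv a \<otimes> q (\<sigma> a b) = q b \<otimes> winv a"
  using conjugate_inverse[OF _ _ _ _ w_winv winv_w w_q] by simp

lemma h_w: "h b \<otimes> w a = w a \<otimes> h (inv_into UNIV (\<sigma> a) b)"
  by (simp add: w_h)

lemma winv_w_cancel [simp]:
  assumes "x \<in> carrier A"
  shows "winv a \<otimes> (w a \<otimes> x) = x" "w a \<otimes> (winv a \<otimes> x) = x"
  using assms by (simp_all flip: m_assoc)

lemma winv_winv: "winv b \<otimes> winv a = winv (\<tau> b a) \<otimes> winv (\<sigma> a b)"
proof (rule inv_unique)
  show "winv b \<otimes> winv a \<otimes> (w a \<otimes> w b) = \<one>"
    by (simp add: m_assoc)
  show "(w a \<otimes> w b) \<otimes> (winv (\<tau> b a) \<otimes> winv (\<sigma> a b)) = \<one>"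
    by (subst w_w) (simp add: m_assoc)
qed simp_all

definition rmat :: "'i::finite \<Rightarrow> 'i \<Rightarrow> ('i \<Rightarrow> 'x) \<Rightarrow> (('i \<Rightarrow> 'a) \<Rightarrow>\<^sub>0 'k) set" where
  "rmat i j = monomial (at_leg j (\<lambda>c. q (c i)))"

definition twist :: "'i::finite \<Rightarrow> 'i \<Rightarrow> ('i \<Rightarrow> 'x) \<Rightarrow> (('i \<Rightarrow> 'a) \<Rightarrow>\<^sub>0 'k) set" where
  "twist i j = monomial (at_leg j (\<lambda>c. winv (c i)))"

text \<open>
  The entries of \<open>\<F>\<^sub>i\<^sub>j\<^sub>k\<close>; any further leg carries the unit.
\<close>

definition twist3_coeff :: "'i \<Rightarrow> 'i \<Rightarrow> 'i \<Rightarrow> ('i::finite \<Rightarrow> 'x) \<Rightarrow> 'i \<Rightarrow> 'a" where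
  "twist3_coeff i j k = (\<lambda>c l. if l = i then \<one> else if l = j then winv (c i)
    else if l = k then winv (c j) \<otimes> winv (c i) else \<one>)"

definition twist3 :: "'i \<Rightarrow> 'i \<Rightarrow> 'i \<Rightarrow> ('i::finite \<Rightarrow> 'x) \<Rightarrow> (('i \<Rightarrow> 'a) \<Rightarrow>\<^sub>0 'k) set" where
  "twist3 i j k = monomial (twist3_coeff i j k)"

lemma shifts_rmat: "shifts (at_leg j (\<lambda>c. q (c i))) (\<lambda>c. c(j := c i \<triangleright> c j))"
  by (rule shifts_at_leg) (simp_all add: h_q)

lemma shifts_twist: "shifts (at_leg j (\<lambda>c. winv (c i))) (\<lambda>c. c(j := \<sigma> (c i) (c j)))"
  by (rule shifts_at_leg) (simp_all add: h_winv)

lemma shifts_inv_twist: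
  "shifts (at_leg j (\<lambda>c. w (c i))) (\<lambda>c. c(j := inv_into UNIV (\<sigma> (c i)) (c j)))"
  by (rule shifts_at_leg) (simp_all add: h_w)

lemma twist3_coeff_closed [simp]: "twist3_coeff i j k c l \<in> carrier A"
  by (simp add: twist3_coeff_def)

lemma shifts_twist3:
  assumes "i \<noteq> j" "j \<noteq> k" "i \<noteq> k"
  shows "shifts (twist3_coeff i j k)
    (\<lambda>c. c(j := \<sigma> (c i) (c j), k := \<sigma> (c i) (\<sigma> (c j) (c k))))"
  unfolding shifts_def
proof (intro allI conjI twist3_coeff_closed)
  fix c l
  have "h (c k) \<otimes> (winv (c j) \<otimes> winv (c i))
      = winv (c j) \<otimes> winv (c i) \<otimes> h (\<sigma> (c i) (\<sigma> (c j) (c k)))"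
    by (simp add: h_winv h_winv_mult m_assoc)
  then show "h (c l) \<otimes> twist3_coeff i j k c l = twist3_coeff i j k c l
      \<otimes> h ((c(j := \<sigma> (c i) (c j), k := \<sigma> (c i) (\<sigma> (c j) (c k)))) l)"
    using assms by (simp add: twist3_coeff_def h_winv)
qed

lemma inv_twist:
  assumes "i \<noteq> j"
  shows "inv\<^bsub>formal_tensor A \<eta> h\<^esub> (twist i j) = monomial (at_leg j (\<lambda>c. w (c i)))"
  unfolding twist_def using assms
  by (intro monomial_inv[OF shifts_twist shifts_inv_twist]) (simp_all add: at_leg_def)

text \<open>
  The labels \<open>(a, b)\<close> of the legs \<open>(i, j)\<close> pass through \<open>\<F>\<^sub>j\<^sub>i\<close>, \<open>\<R>\<^sub>i\<^sub>j\<close> and \<open>\<F>\<^sub>i\<^sub>j\<^sup>-\<^sup>1\<close> as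
  \<open>(a, b) \<mapsto> (x, b) \<mapsto> (x, x \<triangleright> b) \<mapsto> (x, \<sigma>\<^sub>x\<^sup>-\<^sup>1 (x \<triangleright> b))\<close> with \<open>x = \<sigma>\<^sub>b a\<close>. As
  \<open>a = \<sigma>\<^sub>b\<^sup>-\<^sup>1 x\<close>, the hypothesis on \<open>\<triangleright>\<close> says \<open>x \<triangleright> b = \<sigma>\<^sub>x (\<tau>\<^sub>a b)\<close>, and the last label is \<open>\<tau>\<^sub>a b\<close>.
\<close>

lemma twisted_rmat_mult:
  fixes n :: "('i::finite \<Rightarrow> 'x) \<Rightarrow> 'i \<Rightarrow> 'a"
  assumes ij: "i \<noteq> j" and n: "\<And>c l. n c l \<in> carrier A"
  defines "C \<equiv> formal_tensor A \<eta> h"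
  shows "twist j i \<otimes>\<^bsub>C\<^esub> rmat i j \<otimes>\<^bsub>C\<^esub> inv\<^bsub>C\<^esub> (twist i j) \<otimes>\<^bsub>C\<^esub> monomial n
    = monomial (\<lambda>c l. (if l = i then winv (c j)
        else if l = j then q (\<sigma> (c j) (c i)) \<otimes> w (\<sigma> (c j) (c i)) else \<one>)
      \<otimes> n (c(i := \<sigma> (c j) (c i), j := \<tau> (c i) (c j))) l)"
proof -
  have closed: "at_leg l x c l' \<in> carrier A" if "\<And>c. x c \<in> carrier A" for l x c and l' :: 'i
    using that by (simp add: at_leg_def)
  note shifts_FR = shifts_mult[OF shifts_twist[of i j] shifts_rmat[of j i]]
  note shifts_FRF = shifts_mult[OF shifts_FR shifts_inv_twist[of j i]]
  have "twist j i \<otimes>\<^bsub>C\<^esub> rmat i j \<otimes>\<^bsub>C\<^esub> inv\<^bsub>C\<^esub> (twist i j) \<otimes>\<^bsub>C\<^esub> monomial n = monomial (\<lambda>c l.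
      at_leg i (\<lambda>c. winv (c j)) c l
      \<otimes> at_leg j (\<lambda>c. q (c i)) (c(i := \<sigma> (c j) (c i))) l
      \<otimes> at_leg j (\<lambda>c. w (c i)) (c(i := \<sigma> (c j) (c i), j := \<sigma> (c j) (c i) \<triangleright> c j)) l
      \<otimes> n (c(i := \<sigma> (c j) (c i),
          j := inv_into UNIV (\<sigma> (\<sigma> (c j) (c i))) (\<sigma> (c j) (c i) \<triangleright> c j))) l)"
    unfolding C_def inv_twist[OF ij] unfolding twist_def rmat_def
    by (simp only: monomial_mult[OF shifts_twist] monomial_mult[OF shifts_FR]
        monomial_mult[OF shifts_FRF] closed n q_closed w_closed)
      (use ij in simp)
  also have "\<dots> = monomial (\<lambda>c l. (if l = i then winv (c j)
        else if l = j then q (\<sigma> (c j) (c i)) \<otimes> w (\<sigma> (c j) (c i)) else \<one>)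
      \<otimes> n (c(i := \<sigma> (c j) (c i), j := \<tau> (c i) (c j))) l)"
    using ij by (intro monomial_cong) (simp add: at_leg_def n rack_eq)
  finally show ?thesis .
qed

text \<open>
  On leg \<open>k\<close> the letter \<open>w\<close> of the twisted R-matrix cancels the first letter of
  \<open>\<F>\<^sub>i\<^sub>j\<^sub>k\<close>. What remains is \<open>w\<^sub>a\<^sup>-\<^sup>1 q (\<sigma>\<^sub>a x) = q\<^sub>x w\<^sub>a\<^sup>-\<^sup>1\<close>, where \<open>a\<close> is the label
  of leg \<open>i\<close> and \<open>x = \<sigma>\<^sub>c b\<close> for the labels \<open>b\<close> and \<open>c\<close> of \<open>j\<close> and \<open>k\<close>.
\<close>

lemma twist3_rmat_right:
  fixes i j k :: "'i::finite"
  assumes ijk: "i \<noteq> j" "j \<noteq> k" "i \<noteq> k"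
  defines "C \<equiv> formal_tensor A \<eta> h"
  shows "twist3 i k j \<otimes>\<^bsub>C\<^esub> rmat j k
    = twist k j \<otimes>\<^bsub>C\<^esub> rmat j k \<otimes>\<^bsub>C\<^esub> inv\<^bsub>C\<^esub> (twist j k) \<otimes>\<^bsub>C\<^esub> twist3 i j k"
proof -
  have closed: "at_leg k (\<lambda>c. q (c j)) c l \<in> carrier A" for c l
    by (simp add: at_leg_def)
  have "twist3 i k j \<otimes>\<^bsub>C\<^esub> rmat j k = monomial (\<lambda>c l. twist3_coeff i k j c l \<otimes>
      at_leg k (\<lambda>c. q (c j)) (c(k := \<sigma> (c i) (c k), j := \<sigma> (c i) (\<sigma> (c k) (c j)))) l)"
    unfolding C_def twist3_def rmat_def
    by (rule monomial_mult[OF shifts_twist3 closed]) (use ijk in auto)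
  also have "\<dots> = twist k j \<otimes>\<^bsub>C\<^esub> rmat j k \<otimes>\<^bsub>C\<^esub> inv\<^bsub>C\<^esub> (twist j k) \<otimes>\<^bsub>C\<^esub> twist3 i j k"
    unfolding C_def twist3_def twisted_rmat_mult[OF ijk(2) twist3_coeff_closed]
    using ijk by (intro monomial_cong) (auto simp: twist3_coeff_def at_leg_def q_winv m_assoc)
  finally show ?thesis .
qed

text \<open>
  On leg \<open>j\<close> the letters \<open>w\<close> and \<open>w\<^sup>-\<^sup>1\<close> cancel. On leg \<open>k\<close> the words
  \<open>w\<^sub>a\<^sup>-\<^sup>1 w\<^sub>b\<^sup>-\<^sup>1\<close> before and after the relabelling \<open>(a, b) \<mapsto> (\<sigma>\<^sub>b a, \<tau>\<^sub>a b)\<close> have to agree,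
  which is the exchange relation of the \<open>w\<close>.
\<close>

lemma twist3_rmat_left:
  fixes i j k :: "'i::finite"
  assumes ijk: "i \<noteq> j" "j \<noteq> k" "i \<noteq> k"
  defines "C \<equiv> formal_tensor A \<eta> h"
  shows "twist3 j i k \<otimes>\<^bsub>C\<^esub> rmat i j
    = twist j i \<otimes>\<^bsub>C\<^esub> rmat i j \<otimes>\<^bsub>C\<^esub> inv\<^bsub>C\<^esub> (twist i j) \<otimes>\<^bsub>C\<^esub> twist3 i j k"
proof -
  have closed: "at_leg j (\<lambda>c. q (c i)) c l \<in> carrier A" for c l
    by (simp add: at_leg_def)
  have "twist3 j i k \<otimes>\<^bsub>C\<^esub> rmat i j = monomial (\<lambda>c l. twist3_coeff j i k c l \<otimes>
      at_leg j (\<lambda>c. q (c i)) (c(i := \<sigma> (c j) (c i), k := \<sigma> (c j) (\<sigma> (c i) (c k)))) l)"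
    unfolding C_def twist3_def rmat_def
    by (rule monomial_mult[OF shifts_twist3 closed]) (use ijk in auto)
  also have "\<dots> = twist j i \<otimes>\<^bsub>C\<^esub> rmat i j \<otimes>\<^bsub>C\<^esub> inv\<^bsub>C\<^esub> (twist i j) \<otimes>\<^bsub>C\<^esub> twist3 i j k"
    unfolding C_def twist3_def twisted_rmat_mult[OF ijk(1) twist3_coeff_closed]
    using ijk
    by (intro monomial_cong) (auto simp: twist3_coeff_def at_leg_def winv_winv[of "_ i"] m_assoc)
  finally show ?thesis .
qed

lemma place_sum_legs2:
  assumes ij: "i \<noteq> j" and x: "\<And>a. x a \<in> carrier A"
  shows "place_formal A \<eta> h (legs2 i j)
      (formal_sum A \<eta> h UNIV (\<lambda>a. pure_tensor A \<eta> (legs2 (h a) (x a))))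
    = monomial (at_leg j (\<lambda>c. x (c i)))"
proof -
  have "formal_sum A \<eta> h UNIV (\<lambda>a. pure_tensor A \<eta> (legs2 (h a) (x a)))
      = monomial (\<lambda>c. legs2 \<one> (x (c 1)))"
  proof (rule formal_sum_monomial[where g = "\<lambda>c. c 1"])
    show "\<exists>i. h (c i) \<otimes> legs2 (h a) (x a) i = \<zero>" if "a \<noteq> c 1" for c and a
      using that h_orth by (intro exI[of _ 1]) auto
  qed (simp_all add: x legs2_def)
  then show ?thesis
    using place_legs2[OF ij, of x] x by simp
qed

lemma place_twist3:
  fixes i j k :: 3
  assumes ijk: "i \<noteq> j" "j \<noteq> k" "i \<noteq> k"
  shows "place_formal A \<eta> h (legs3 i j k) (twist3 1 2 3) = twist3 i j k"
proof -
  have "place_family A (legs3 i j k) (twist3_coeff 1 2 3 (c \<circ> legs3 i j k)) l = twist3_coeff i j k c l"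
    for c l
    using exhaust_3_distinct[OF ijk, of l] ijk
      place_family_hit[OF inj_legs3[OF ijk], of A "twist3_coeff 1 2 3 (c \<circ> legs3 i j k)" 1]
      place_family_hit[OF inj_legs3[OF ijk], of A "twist3_coeff 1 2 3 (c \<circ> legs3 i j k)" 2]
      place_family_hit[OF inj_legs3[OF ijk], of A "twist3_coeff 1 2 3 (c \<circ> legs3 i j k)" 3]
    by (auto simp: twist3_coeff_def)
  then have "(\<lambda>c. place_family A (legs3 i j k) (twist3_coeff 1 2 3 (c \<circ> legs3 i j k))) = twist3_coeff i j k"
    by (intro ext)
  then show ?thesis
    by (simp add: twist3_def place_formal_monomial[OF inj_legs3[OF ijk]])
qed

text \<open>
  This and the next lemma are the two factorisations of \<open>\<F>\<^sub>1\<^sub>2\<^sub>3\<close>: both products are the same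
  monomial.
\<close>

lemma twist_mult_sum_1_23:
  "twist 2 3 \<otimes>\<^bsub>formal_tensor A \<eta> h\<^esub>
      formal_sum A \<eta> h UNIV (\<lambda>a. pure_tensor A \<eta> (legs3 (h a) (winv a) (winv a)))
    = twist3 1 2 3"
proof -
  have sum: "formal_sum A \<eta> h UNIV (\<lambda>a. pure_tensor A \<eta> (legs3 (h a) (winv a) (winv a)))
      = monomial (\<lambda>c. legs3 \<one> (winv (c 1)) (winv (c 1)))"
  proof (rule formal_sum_monomial[where g = "\<lambda>c. c 1"])
    show "\<exists>i. h (c i) \<otimes> legs3 (h a) (winv a) (winv a) i = \<zero>" if "a \<noteq> c 1" for c and a
      using that h_orth by (intro exI[of _ 1]) auto
  qed (simp_all add: legs3_def)
  have closed: "legs3 \<one> (winv a) (winv a) l \<in> carrier A" for a l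
    by (simp add: legs3_def)
  have "at_leg 3 (\<lambda>c. winv (c 2)) c l \<otimes> legs3 \<one> (winv (c 1)) (winv (c 1)) l = twist3_coeff 1 2 3 c l" for c l
    using exhaust_3_distinct[of 1 2 3 l] by (auto simp: twist3_coeff_def)
  then show ?thesis
    unfolding sum twist_def twist3_def
    by (simp add: monomial_mult[OF shifts_twist closed])
qed

text \<open>
  The labelling \<open>c\<close> selects the summand with \<open>a = c 1\<close> and \<open>\<sigma>\<^sub>a b = c 2\<close>; since \<open>\<F>\<^sub>1\<^sub>2\<close> relabels leg 2
  by \<open>\<sigma>\<^sub>a\<close>, its index \<open>b\<close> is the original label of leg 2.
\<close>

lemma twist_mult_sum_12_3:
  "twist 1 2 \<otimes>\<^bsub>formal_tensor A \<eta> h\<^esub>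
      formal_sum A \<eta> h UNIV
        (\<lambda>(a, b). pure_tensor A \<eta> (legs3 (h a) (h (\<sigma> a b)) (winv b \<otimes> winv a)))
    = twist3 1 2 3"
proof -
  let ?f = "\<lambda>(a, b). legs3 (h a) (h (\<sigma> a b)) (winv b \<otimes> winv a)"
  let ?m = "\<lambda>c. legs3 \<one> \<one> (winv (inv_into UNIV (\<sigma> (c 1)) (c 2)) \<otimes> winv (c 1))"
  have "formal_sum A \<eta> h UNIV (\<lambda>s. pure_tensor A \<eta> (?f s)) = monomial ?m"
  proof (rule formal_sum_monomial[where g = "\<lambda>c. (c 1, inv_into UNIV (\<sigma> (c 1)) (c 2))"])
    fix c :: "3 \<Rightarrow> 'x" and s
    assume s: "s \<noteq> (c 1, inv_into UNIV (\<sigma> (c 1)) (c 2))"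
    obtain a b where ab: "s = (a, b)"
      by fastforce
    show "\<exists>i. h (c i) \<otimes> ?f s i = \<zero>"
    proof (cases "a = c 1")
      case True
      then have "\<sigma> a b \<noteq> c 2"
        using s ab \<sigma>_inv(2)[of a b] by metis
      then show ?thesis
        using ab h_orth by (intro exI[of _ 2]) auto
    next
      case False
      then show ?thesis
        using ab h_orth by (intro exI[of _ 1]) auto
    qed
  qed (auto simp: legs3_def)
  moreover have "(\<lambda>s. pure_tensor A \<eta> (?f s))
      = (\<lambda>(a, b). pure_tensor A \<eta> (legs3 (h a) (h (\<sigma> a b)) (winv b \<otimes> winv a)))"
    by auto
  ultimately have sum: "formal_sum A \<eta> h UNIV
      (\<lambda>(a, b). pure_tensor A \<eta> (legs3 (h a) (h (\<sigma> a b)) (winv b \<otimes> winv a))) = monomial ?m"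
    by simp
  have closed: "?m c l \<in> carrier A" for c l
    by (simp add: legs3_def)
  have "at_leg 2 (\<lambda>c. winv (c 1)) c l \<otimes> ?m (c(2 := \<sigma> (c 1) (c 2))) l = twist3_coeff 1 2 3 c l" for c l
    using exhaust_3_distinct[of 1 2 3 l] by (auto simp: twist3_coeff_def)
  then show ?thesis
    unfolding sum twist_def twist3_def by (subst monomial_mult[OF shifts_twist closed]) simp
qed

end

section \<open>Presented algebras\<close>

lemma ring_type_algebra: "ring (ring_of_type_algebra :: 'a::ring_1 ring)"
proof (rule ringI)
  let ?R = "ring_of_type_algebra :: 'a ring"
  show "abelian_group ?R"
  proof (rule abelian_groupI)
    fix x
    show "\<exists>y\<in>carrier ?R. y \<oplus>\<^bsub>?R\<^esub> x = \<zero>\<^bsub>?R\<^esub>"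
      by (rule bexI[of _ "- x"]) (simp_all add: ring_of_type_algebra_def)
  qed (simp_all add: ring_of_type_algebra_def add_ac)
  show "monoid ?R"
    by (rule monoidI) (simp_all add: ring_of_type_algebra_def mult.assoc)
qed (simp_all add: ring_of_type_algebra_def algebra_simps)

lemma ideal_relation_ideal: "ideal (relation_ideal S) ring_of_type_algebra"
  unfolding relation_ideal_def
  by (rule ring.genideal_ideal[OF ring_type_algebra]) (simp add: ring_of_type_algebra_def)

lemma ring_presented_algebra: "ring (presented_algebra S)"
  unfolding presented_algebra_def by (rule ideal.quotient_is_ring[OF ideal_relation_ideal])

lemma presented_class_hom:
  "ring_hom_ring ring_of_type_algebra (presented_algebra S) (presented_class S)"
proof -
  have "presented_class S = (+>\<^bsub>ring_of_type_algebra\<^esub>) (relation_ideal S)"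
    by (simp add: presented_class_def fun_eq_iff)
  then show ?thesis
    unfolding presented_algebra_def using ideal.rcos_ring_hom_ring[OF ideal_relation_ideal[of S]] by simp
qed

lemma presented_class_closed: "presented_class S p \<in> carrier (presented_algebra S)"
  by (rule ring_hom_closed[OF ring_hom_ring.homh[OF presented_class_hom]])
    (simp add: ring_of_type_algebra_def)

lemma presented_class_mult:
  "presented_class S p \<otimes>\<^bsub>presented_algebra S\<^esub> presented_class S q = presented_class S (p * q)"
  using ring_hom_mult[OF ring_hom_ring.homh[OF presented_class_hom[of S]], of p q]
  by (simp add: ring_of_type_algebra_def)

lemma presented_class_one: "presented_class S 1 = \<one>\<^bsub>presented_algebra S\<^esub>"
  using ring_hom_one[OF ring_hom_ring.homh[OF presented_class_hom[of S]]]
  by (simp add: ring_of_type_algebra_def)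

lemma presented_class_zero: "presented_class S 0 = \<zero>\<^bsub>presented_algebra S\<^esub>"
proof -
  interpret hom: ring_hom_ring ring_of_type_algebra "presented_algebra S" "presented_class S"
    by (rule presented_class_hom)
  show ?thesis
    using hom.hom_zero by (simp add: ring_of_type_algebra_def)
qed

lemma presented_class_eq:
  assumes "p - q \<in> S"
  shows "presented_class S p = presented_class S q"
proof -
  let ?R = "ring_of_type_algebra"
  interpret I: ideal "relation_ideal S" ?R
    by (rule ideal_relation_ideal)
  interpret hom: ring_hom_ring ?R "presented_algebra S" "presented_class S"
    by (rule presented_class_hom)
  have "p - q \<in> relation_ideal S"
    using I.genideal_self[of S] assms by (auto simp: relation_ideal_def ring_of_type_algebra_def)
  then have zero: "presented_class S (p - q) = \<zero>\<^bsub>presented_algebra S\<^esub>"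
    by (simp add: presented_class_def presented_algebra_def FactRing_def I.a_rcos_const)
  have "presented_class S (p - q \<oplus>\<^bsub>?R\<^esub> q) = presented_class S (p - q) \<oplus>\<^bsub>presented_algebra S\<^esub> presented_class S q"
    by (rule hom.hom_add) (simp_all add: ring_of_type_algebra_def)
  also have "\<dots> = presented_class S q"
    unfolding zero by (rule hom.S.l_zero[OF presented_class_closed])
  finally show ?thesis
    by (simp add: ring_of_type_algebra_def)
qed

section \<open>The decorated rack algebra\<close>

context
  fixes rk :: "'x \<Rightarrow> 'x \<Rightarrow> 'x" (infixl \<open>\<triangleright>\<close> 70) and \<sigma> \<tau> :: "'x \<Rightarrow> 'x \<Rightarrow> 'x"
begin

abbreviation dra_w :: "'x \<Rightarrow> ('x, 'k::field) dra" where "dra_w a \<equiv> dra_gen (\<triangleright>) \<sigma> \<tau> (W a)"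

lemmas dra_defs = dra_def dra_gen_def dra_q_def dra_h_def dra_winv_def

lemma decorated_family_dra:
  assumes bij: "\<And>a. bij (\<sigma> a)"
    and rack_eq: "\<And>a b. b \<triangleright> a = \<sigma> b (\<tau> (inv_into UNIV (\<sigma> a) b) a)"
  shows "decorated_family (dra (\<triangleright>) \<sigma> \<tau> :: ('x, 'k::field) dra ring) (dra_unit (\<triangleright>) \<sigma> \<tau>)
    (dra_h (\<triangleright>) \<sigma> \<tau>) (\<triangleright>) \<sigma> \<tau> (dra_q (\<triangleright>) \<sigma> \<tau>) dra_w (dra_winv (\<triangleright>) \<sigma> \<tau>)"
proof -
  let ?A = "dra (\<triangleright>) \<sigma> \<tau> :: ('x, 'k::field) dra ring"
  let ?S = "decorated_relators (\<triangleright>) \<sigma> \<tau> :: ('x rack_gen, 'k) free_algebra set"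
  note [simp] = presented_class_mult presented_class_closed
  interpret ring ?A
    unfolding dra_def by (rule ring_presented_algebra)
  have rack: "presented_class ?S p = presented_class ?S p'" if "p - p' \<in> rack_relators (\<triangleright>)" for p p'
    using that by (intro presented_class_eq decorated_relators.intros(1))
  show ?thesis
  proof unfold_locales
    fix a b c
    show "dra_unit (\<triangleright>) \<sigma> \<tau> c \<in> carrier ?A"
      by (simp add: dra_unit_def dra_def)
    show "dra_h (\<triangleright>) \<sigma> \<tau> a \<in> carrier ?A" "dra_q (\<triangleright>) \<sigma> \<tau> a \<in> carrier ?A"
      "dra_gen (\<triangleright>) \<sigma> \<tau> (W a) \<in> carrier ?A" "dra_winv (\<triangleright>) \<sigma> \<tau> a \<in> carrier ?A"
      by (simp_all add: dra_defs)
    show "dra_h (\<triangleright>) \<sigma> \<tau> a \<otimes>\<^bsub>?A\<^esub> dra_h (\<triangleright>) \<sigma> \<tau> a = dra_h (\<triangleright>) \<sigma> \<tau> a"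
      using rack[OF rack_relators.intros(4)[of a a]] by (simp add: dra_defs)
    show "dra_h (\<triangleright>) \<sigma> \<tau> a \<otimes>\<^bsub>?A\<^esub> dra_h (\<triangleright>) \<sigma> \<tau> b = \<zero>\<^bsub>?A\<^esub>" if "a \<noteq> b"
      using rack[OF rack_relators.intros(4)[of a b]] that by (simp add: dra_defs presented_class_zero)
    show "dra_h (\<triangleright>) \<sigma> \<tau> a \<otimes>\<^bsub>?A\<^esub> dra_q (\<triangleright>) \<sigma> \<tau> b
        = dra_q (\<triangleright>) \<sigma> \<tau> b \<otimes>\<^bsub>?A\<^esub> dra_h (\<triangleright>) \<sigma> \<tau> (b \<triangleright> a)"
      using rack[OF rack_relators.intros(5)[of b _ a]] by (simp add: dra_defs)
    show "dra_winv (\<triangleright>) \<sigma> \<tau> a \<otimes>\<^bsub>?A\<^esub> dra_gen (\<triangleright>) \<sigma> \<tau> (W a) = \<one>\<^bsub>?A\<^esub>"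
      using presented_class_eq[OF decorated_relators.intros(2)] by (simp add: dra_defs presented_class_one)
    show "dra_gen (\<triangleright>) \<sigma> \<tau> (W a) \<otimes>\<^bsub>?A\<^esub> dra_winv (\<triangleright>) \<sigma> \<tau> a = \<one>\<^bsub>?A\<^esub>"
      using presented_class_eq[OF decorated_relators.intros(3)] by (simp add: dra_defs presented_class_one)
    show "dra_gen (\<triangleright>) \<sigma> \<tau> (W a) \<otimes>\<^bsub>?A\<^esub> dra_gen (\<triangleright>) \<sigma> \<tau> (W b)
        = dra_gen (\<triangleright>) \<sigma> \<tau> (W (\<sigma> a b)) \<otimes>\<^bsub>?A\<^esub> dra_gen (\<triangleright>) \<sigma> \<tau> (W (\<tau> b a))"
      using presented_class_eq[OF decorated_relators.intros(4)] by (simp add: dra_defs)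
    show "dra_gen (\<triangleright>) \<sigma> \<tau> (W a) \<otimes>\<^bsub>?A\<^esub> dra_h (\<triangleright>) \<sigma> \<tau> b
        = dra_h (\<triangleright>) \<sigma> \<tau> (\<sigma> a b) \<otimes>\<^bsub>?A\<^esub> dra_gen (\<triangleright>) \<sigma> \<tau> (W a)"
      using presented_class_eq[OF decorated_relators.intros(5)] by (simp add: dra_defs)
    show "dra_gen (\<triangleright>) \<sigma> \<tau> (W a) \<otimes>\<^bsub>?A\<^esub> dra_q (\<triangleright>) \<sigma> \<tau> b
        = dra_q (\<triangleright>) \<sigma> \<tau> (\<sigma> a b) \<otimes>\<^bsub>?A\<^esub> dra_gen (\<triangleright>) \<sigma> \<tau> (W a)"
      using presented_class_eq[OF decorated_relators.intros(6)] by (simp add: dra_defs)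
  qed (rule bij, rule rack_eq)
qed

end

theorem theorem5p22:
  fixes rk :: "'x::countable \<Rightarrow> 'x \<Rightarrow> 'x" (infixl \<open>\<triangleright>\<close> 70)
    and \<sigma> \<tau> :: "'x \<Rightarrow> 'x \<Rightarrow> 'x"
  assumes "finite (UNIV :: 'x set) \<or> (\<forall>a. surj (\<lambda>b. a \<triangleright> b))"
    and "\<forall>a. bij (\<sigma> a)"
    and "\<forall>a b. (dra_h (\<triangleright>) \<sigma> \<tau> a :: ('x, 'k::field) dra) = dra_h (\<triangleright>) \<sigma> \<tau> b \<longleftrightarrow> a = b"
    and "\<forall>a b. b \<triangleright> a = \<sigma> b (\<tau> (inv_into UNIV (\<sigma> a) b) a)"
  shows
    "let C = (dra_formal (\<triangleright>) \<sigma> \<tau> :: ('x, 'k, 3) dra_tensor ring);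
         R = (\<lambda>i j :: 3. dra_place (\<triangleright>) \<sigma> \<tau> (legs2 i j) (rack_R (\<triangleright>) \<sigma> \<tau>));
         F = (\<lambda>i j :: 3. dra_place (\<triangleright>) \<sigma> \<tau> (legs2 i j) (twist_F (\<triangleright>) \<sigma> \<tau>));
         RF = (\<lambda>i j :: 3. F j i \<otimes>\<^bsub>C\<^esub> R i j \<otimes>\<^bsub>C\<^esub> inv\<^bsub>C\<^esub> (F i j));
         F1_23 = twist_F1_23 (\<triangleright>) \<sigma> \<tau>;
         Fstar12_3 = twist_Fstar12_3 (\<triangleright>) \<sigma> \<tau>;
         F123 = F 2 3 \<otimes>\<^bsub>C\<^esub> F1_23;
         FF = (\<lambda>i j k :: 3. dra_place (\<triangleright>) \<sigma> \<tau> (legs3 i j k) F123)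
     in F 1 2 \<otimes>\<^bsub>C\<^esub> Fstar12_3 = F 2 3 \<otimes>\<^bsub>C\<^esub> F1_23 \<and>
        (\<forall>i j k. i \<noteq> j \<and> j \<noteq> k \<and> i \<noteq> k \<longrightarrow>
           FF i k j \<otimes>\<^bsub>C\<^esub> R j k = RF j k \<otimes>\<^bsub>C\<^esub> FF i j k \<and>
           FF j i k \<otimes>\<^bsub>C\<^esub> R i j = RF i j \<otimes>\<^bsub>C\<^esub> FF i j k)"
proof -
  interpret decorated_family "dra (\<triangleright>) \<sigma> \<tau> :: ('x, 'k) dra ring" "dra_unit (\<triangleright>) \<sigma> \<tau>"
    "dra_h (\<triangleright>) \<sigma> \<tau>" "(\<triangleright>)" \<sigma> \<tau> "dra_q (\<triangleright>) \<sigma> \<tau>" "dra_w (\<triangleright>) \<sigma> \<tau>" "dra_winv (\<triangleright>) \<sigma> \<tau>"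
    using assms by (intro decorated_family_dra) auto
  have R: "dra_place (\<triangleright>) \<sigma> \<tau> (legs2 i j) (rack_R (\<triangleright>) \<sigma> \<tau>) = rmat i j" if "i \<noteq> j" for i j :: 3
    unfolding dra_place_def rack_R_def dra_sum_def dra_pure_def rmat_def
    using that by (rule place_sum_legs2) simp
  have F: "dra_place (\<triangleright>) \<sigma> \<tau> (legs2 i j) (twist_F (\<triangleright>) \<sigma> \<tau>) = twist i j" if "i \<noteq> j" for i j :: 3
    unfolding dra_place_def twist_F_def dra_sum_def dra_pure_def twist_def
    using that by (rule place_sum_legs2) simp
  have F123: "twist 2 3 \<otimes>\<^bsub>dra_formal (\<triangleright>) \<sigma> \<tau>\<^esub> twist_F1_23 (\<triangleright>) \<sigma> \<tau> = twist3 1 2 3"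
    unfolding dra_formal_def twist_F1_23_def dra_sum_def dra_pure_def by (rule twist_mult_sum_1_23)
  have F123': "twist 1 2 \<otimes>\<^bsub>dra_formal (\<triangleright>) \<sigma> \<tau>\<^esub> twist_Fstar12_3 (\<triangleright>) \<sigma> \<tau> = twist3 1 2 3"
    unfolding dra_formal_def twist_Fstar12_3_def dra_sum_def dra_pure_def by (rule twist_mult_sum_12_3)
  have FF: "dra_place (\<triangleright>) \<sigma> \<tau> (legs3 i j k) (twist3 1 2 3) = twist3 i j k"
    if "i \<noteq> j" "j \<noteq> k" "i \<noteq> k" for i j k :: 3
    unfolding dra_place_def using that by (rule place_twist3)
  show ?thesis
    unfolding Let_def
    by (intro conjI allI impI; (elim conjE)?; simp add: R F F123 F123' FF)
      (simp_all add: dra_formal_def twist3_rmat_right twist3_rmat_left)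
qed

end
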